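(* Let $\rho(\mathbf x,t)$ be the solution of the Fokker-Planck equation $\partial_t\rho=\mathcal L_t\rho$, expanded in the foot states as $$\rho(\mathbf x,t)=\sum_{n\ge 0}\sum_{\boldsymbol\alpha_n}A_{n,\boldsymbol\alpha_n}(t)\,e^{-\int_{t_i}^t ds\,\lambda_n(s)}\,\underline\rho_{n,\boldsymbol\alpha_n}(\mathbf x,\mathbf a_t),\qquad A_{n,\boldsymbol\alpha_n}(t)=\sum_{\boldsymbol\beta_n}[\mathbf M^{(n)}(t)]_{\boldsymbol\alpha_n,\boldsymbol\beta_n}C_{n,\boldsymbol\beta_n}(t).$$ Then the coefficients $C_{n,\boldsymbol\alpha_n}$ satisfy, for all $n\ge0$ and all $\boldsymbol\alpha_n$, $$\partial_tC_{n,\boldsymbol\alpha_n}(t)+\sum_{\boldsymbol\beta_n}\ \sum_{m\ge0,\,m\ne n}\ \sum_{\boldsymbol\gamma_m,\boldsymbol\delta_m}e^{\int_{t_i}^tds\,(\lambda_n(s)-\lambda_m(s))}\,\frac{[\mathbf M^{(n)}(t)]^{-1}_{\boldsymbol\alpha_n,\boldsymbol\beta_n}\,[\dot{\mathbf L}^{(n,m)}(t)]_{\boldsymbol\beta_n,\boldsymbol\gamma_m}\,[\mathbf M^{(m)}(t)]_{\boldsymbol\gamma_m,\boldsymbol\delta_m}}{\lambda_n(t)-\lambda_m(t)}\,C_{m,\boldsymbol\delta_m}(t)=0 .$$ Moreover $C_{0,\mathbf 0}(t)=C_{0,\mathbf 0}(t_i)$ for all $t$.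
   Context: Let $\nu,\beta>0$, let $V(\mathbf x,\mathbf a)$ be a smooth confining potential on $\mathbb R^D$ depending on control parameters $\mathbf a$, and let $t\mapsto\mathbf a_t$ be smooth, $t\ge t_i$. The Fokker-Planck operator is $\mathcal L_t f=\nabla\cdot\{\frac1{\nu\beta}\nabla f+\frac1\nu(\nabla V(\cdot,\mathbf a_t))f\}$ and its adjoint is $\mathcal L_t^\dagger g=\frac1{\nu\beta}\nabla^2g-\frac1\nu(\nabla V(\cdot,\mathbf a_t))\cdot\nabla g$. Solutions $\rho(\mathbf x,t)$ vanish rapidly as $|\mathbf x|\to\infty$. The self-adjoint operator $\mathcal H_t=-\frac1{\nu\beta}\nabla^2-\frac1{2\nu}(\nabla^2V)+\frac\beta{4\nu}(\nabla V)^2$ (with $V=V(\cdot,\mathbf a_t)$) has distinct eigenvalues $0=\lambda_0(t)<\lambda_1(t)<\lambda_2(t)<\cdots$ and a complete orthonormal system of real eigenfunctions $u_{n,\boldsymbol\alpha_n}(\mathbf x,\mathbf a_t)$, $\mathcal H_tu_{n,\boldsymbol\alpha_n}=\lambda_n(t)u_{n,\boldsymbol\alpha_n}$, where the finite multi-index $\boldsymbol\alpha_n$ labels the degeneracy of $\lambda_n(t)$; $\lambda_0$ is non-degenerate ($\boldsymbol\alpha_0=\mathbf 0$). The range of the indices $n,\boldsymbol\alpha_n$ is assumed independent of $t$. For arbitrary positive real factors $\mathcal N_{n,\boldsymbol\alpha_n}(\mathbf a_t)$, the foot and head states are $$\underline\rho_{n,\boldsymbol\alpha_n}=\sqrt{\mathcal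 N_{n,\boldsymbol\alpha_n}}\,e^{-\beta V/2}u_{n,\boldsymbol\alpha_n},\qquad \overline\rho_{n,\boldsymbol\alpha_n}=\frac1{\sqrt{\mathcal N_{n,\boldsymbol\alpha_n}}}\,e^{\beta V/2}u_{n,\boldsymbol\alpha_n},$$ so that $\mathcal L_t\underline\rho_{n,\boldsymbol\alpha_n}=-\lambda_n\underline\rho_{n,\boldsymbol\alpha_n}$, $\mathcal L_t^\dagger\overline\rho_{n,\boldsymbol\alpha_n}=-\lambda_n\overline\rho_{n,\boldsymbol\alpha_n}$, $\int d^D\mathbf x\,\overline\rho_{n,\boldsymbol\alpha_n}\underline\rho_{m,\boldsymbol\beta_m}=\delta_{n,m}\delta_{\boldsymbol\alpha_n,\boldsymbol\beta_m}$, and the two families form a complete bi-orthogonal system. The matrices $\mathbf M^{(n)}(t)$ solve $$\partial_t[\mathbf M^{(n)}(t)]_{\boldsymbol\alpha_n,\boldsymbol\beta_n}=-\sum_{\boldsymbol\gamma_n}\Big(\int d^D\mathbf x\,\overline\rho_{n,\boldsymbol\alpha_n}(\mathbf x,\mathbf a_t)\,\partial_t\underline\rho_{n,\boldsymbol\gamma_n}(\mathbf x,\mathbf a_t)\Big)[\mathbf M^{(n)}(t)]_{\boldsymbol\gamma_n,\boldsymbol\beta_n},\qquad [\mathbf M^{(n)}(t_i)]_{\boldsymbol\alpha_n,\boldsymbol\beta_n}=\delta_{\boldsymbol\alpha_n,\boldsymbol\beta_n},$$ and $$[\dot{\mathbf L}^{(n,m)}(t)]_{\boldsymbol\alpha_n,\boldsymbol\beta_m}=\int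 d^D\mathbf x\,\overline\rho_{n,\boldsymbol\alpha_n}(\mathbf x,\mathbf a_t)\,(\partial_t\mathcal L_t)\,\underline\rho_{m,\boldsymbol\beta_m}(\mathbf x,\mathbf a_t),$$ where $\partial_t\mathcal L_t f=\frac1\nu\nabla\cdot\{(\nabla\partial_tV(\cdot,\mathbf a_t))f\}$. All sums over multi-indices run over the full degeneracy range. As usual in such spectral expansions, the eigenvalues and eigenfunctions are assumed to depend smoothly on $t$, with enough decay and convergence that the series may be differentiated and integrated term by term. *)

theory Defs
  imports "HOL-Analysis.Analysis"
begin

text \<open>Times range over \<open>t \<ge> t\<^sub>i\<close>, so the time derivative is one-sided at \<open>t\<^sub>i\<close>
  (and the ordinary one for \<open>t > t\<^sub>i\<close>). Functions of space and time are written \<open>F x t\<close>.\<close>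

definition dt :: "real \<Rightarrow> (real \<Rightarrow> real) \<Rightarrow> real \<Rightarrow> real" where
  "dt ti f t = vector_derivative f (at t within {ti..})"

definition pd :: "'x::euclidean_space \<Rightarrow> ('x \<Rightarrow> real) \<Rightarrow> 'x \<Rightarrow> real" where
  "pd b f x = deriv (\<lambda>h. f (x + h *\<^sub>R b)) 0"

definition grad :: "('x::euclidean_space \<Rightarrow> real) \<Rightarrow> 'x \<Rightarrow> 'x" where
  "grad f x = (\<Sum>b\<in>Basis. pd b f x *\<^sub>R b)"

definition divergence :: "('x::euclidean_space \<Rightarrow> 'x) \<Rightarrow> 'x \<Rightarrow> real" where
  "divergence F x = (\<Sum>b\<in>Basis. pd b (\<lambda>y. F y \<bullet> b) x)"

definition laplacian :: "('x::euclidean_space \<Rightarrow> real) \<Rightarrow> 'x \<Rightarrow> real" where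
  "laplacian f = divergence (grad f)"

text \<open>The derivatives are taken within \<open>S\<close>; this is used for open sets and for half-spaces
  \<open>UNIV \<times> {t\<^sub>i..}\<close>, where they are unique.\<close>

primrec Ck_on :: "nat \<Rightarrow> 'a::euclidean_space set \<Rightarrow> ('a \<Rightarrow> 'b::real_normed_vector) \<Rightarrow> bool" where
  "Ck_on 0 S f \<longleftrightarrow> continuous_on S f"
| "Ck_on (Suc k) S f \<longleftrightarrow>
     (\<exists>f'. (\<forall>z\<in>S. (f has_derivative f' z) (at z within S)) \<and> (\<forall>v. Ck_on k S (\<lambda>z. f' z v)))"

definition smooth_on :: "'a::euclidean_space set \<Rightarrow> ('a \<Rightarrow> 'b::real_normed_vector) \<Rightarrow> bool" where
  "smooth_on S f \<longleftrightarrow> (\<forall>k. Ck_on k S f)"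

definition confining :: "('x::euclidean_space \<Rightarrow> real) \<Rightarrow> bool" where
  "confining W \<longleftrightarrow> filterlim W at_top at_infinity"

definition fokker_planck ::
  "real \<Rightarrow> real \<Rightarrow> ('x::euclidean_space \<Rightarrow> real) \<Rightarrow> ('x \<Rightarrow> real) \<Rightarrow> 'x \<Rightarrow> real" where
  "fokker_planck \<nu> \<beta> W f =
     divergence (\<lambda>x. (1 / (\<nu> * \<beta>)) *\<^sub>R grad f x + (1 / \<nu>) *\<^sub>R (f x *\<^sub>R grad W x))"

text \<open>The operator \<open>\<partial>\<^sub>t L\<^sub>t\<close>; the argument \<open>W'\<close> is \<open>\<partial>\<^sub>t V(\<cdot>, a\<^sub>t)\<close>.\<close>

definition fokker_planck_dt ::
  "real \<Rightarrow> ('x::euclidean_space \<Rightarrow> real) \<Rightarrow> ('x \<Rightarrow> real) \<Rightarrow> 'x \<Rightarrow> real" where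
  "fokker_planck_dt \<nu> W' f x = (1 / \<nu>) * divergence (\<lambda>y. f y *\<^sub>R grad W' y) x"

definition hamiltonian ::
  "real \<Rightarrow> real \<Rightarrow> ('x::euclidean_space \<Rightarrow> real) \<Rightarrow> ('x \<Rightarrow> real) \<Rightarrow> 'x \<Rightarrow> real" where
  "hamiltonian \<nu> \<beta> W f x =
     - (1 / (\<nu> * \<beta>)) * laplacian f x - (1 / (2 * \<nu>)) * laplacian W x * f x
     + (\<beta> / (4 * \<nu>)) * (norm (grad W x))\<^sup>2 * f x"

definition square_integrable :: "('x::euclidean_space \<Rightarrow> real) \<Rightarrow> bool" where
  "square_integrable f \<longleftrightarrow> f \<in> borel_measurable lborel \<and> integrable lborel (\<lambda>x. (f x)\<^sup>2)"

definition complete_orthonormal ::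
  "(nat \<Rightarrow> 'i set) \<Rightarrow> (nat \<Rightarrow> 'i \<Rightarrow> 'x::euclidean_space \<Rightarrow> real) \<Rightarrow> bool" where
  "complete_orthonormal I \<phi> \<longleftrightarrow>
     (\<forall>n. \<forall>i\<in>I n. square_integrable (\<phi> n i)) \<and>
     (\<forall>n m. \<forall>i\<in>I n. \<forall>j\<in>I m.
        (\<integral>x. \<phi> n i x * \<phi> m j x \<partial>lborel) = (if n = m \<and> i = j then 1 else 0)) \<and>
     (\<forall>f. square_integrable f \<longrightarrow>
        (\<lambda>K. \<integral>x. (f x - (\<Sum>n<K. \<Sum>i\<in>I n. (\<integral>y. \<phi> n i y * f y \<partial>lborel) * \<phi> n i x))\<^sup>2 \<partial>lborel)
          \<longlonglongrightarrow> 0)"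

text \<open>Quantitative form of ``enough decay'': \<open>F\<close> and its derivatives of the orders entering the
  time-differentiated Fokker-Planck equation (at most one in time, two in space) decrease faster
  than every power of \<open>norm x\<close>, also after multiplication by any monomial in the corresponding
  derivatives of the potential \<open>W\<close>, locally uniformly in time.\<close>

definition jet ::
  "real \<Rightarrow> ('x::euclidean_space \<Rightarrow> real \<Rightarrow> real) \<Rightarrow> ('x \<Rightarrow> real \<Rightarrow> real) set" where
  "jet ti F =
     (\<Union>G\<in>{F, \<lambda>x t. dt ti (F x) t}.
        {G} \<union> (\<Union>b\<in>Basis. {\<lambda>x t. pd b (\<lambda>y. G y t) x})
            \<union> (\<Union>b\<in>Basis. \<Union>c\<in>Basis. {\<lambda>x t. pd b (pd c (\<lambda>y. G y t)) x}))"

definition rapidly_decaying ::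
  "real \<Rightarrow> ('x::euclidean_space \<Rightarrow> real \<Rightarrow> real) \<Rightarrow> ('x \<Rightarrow> real \<Rightarrow> real) \<Rightarrow> bool" where
  "rapidly_decaying ti W F \<longleftrightarrow>
     (\<forall>g\<in>jet ti F. \<forall>ws. set ws \<subseteq> jet ti W \<longrightarrow>
        (\<forall>k T. \<exists>C. \<forall>t\<in>{ti..T}. \<forall>x.
           (1 + norm x) ^ k * (\<Prod>w\<leftarrow>ws. \<bar>w x t\<bar>) * \<bar>g x t\<bar> \<le> C))"

definition solves_fokker_planck ::
  "real \<Rightarrow> real \<Rightarrow> real \<Rightarrow> ('x::euclidean_space \<Rightarrow> real \<Rightarrow> real) \<Rightarrow> ('x \<Rightarrow> real \<Rightarrow> real) \<Rightarrow> bool" where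
  "solves_fokker_planck ti \<nu> \<beta> W \<rho> \<longleftrightarrow>
     (\<forall>t\<ge>ti. Ck_on 2 UNIV (\<lambda>x. \<rho> x t) \<and>
        (\<forall>x. (\<rho> x has_real_derivative
                 fokker_planck \<nu> \<beta> (\<lambda>y. W y t) (\<lambda>y. \<rho> y t) x) (at t within {ti..})))"

definition integrates_termwise ::
  "('x::euclidean_space \<Rightarrow> real) \<Rightarrow> (nat \<Rightarrow> 'x \<Rightarrow> real) \<Rightarrow> ('x \<Rightarrow> real) \<Rightarrow> bool" where
  "integrates_termwise h F f \<longleftrightarrow>
     (\<forall>n. integrable lborel (\<lambda>x. h x * F n x)) \<and> integrable lborel (\<lambda>x. h x * f x) \<and>
     (\<lambda>n. \<integral>x. h x * F n x \<partial>lborel) sums (\<integral>x. h x * f x \<partial>lborel)"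

text \<open>A matrix indexed by a finite set \<open>S\<close> is a function of which only the values on
  \<open>S \<times> S\<close> matter; the inverse is unique there whenever it exists.\<close>

definition matrix_inverse_on ::
  "'i set \<Rightarrow> ('i \<Rightarrow> 'i \<Rightarrow> real) \<Rightarrow> 'i \<Rightarrow> 'i \<Rightarrow> real" where
  "matrix_inverse_on S A = (SOME B. \<forall>i\<in>S. \<forall>j\<in>S.
     (\<Sum>k\<in>S. A i k * B k j) = (if i = j then 1 else 0) \<and>
     (\<Sum>k\<in>S. B i k * A k j) = (if i = j then 1 else 0))"

end

theory Submission
  imports Defs "HOL-Probability.Sinc_Integral" "Jordan_Normal_Form.Determinant"
begin

text \<open>Pairing \<open>\<partial>\<^sub>t \<rho> = L \<rho>\<close> with a head state and using bi-orthogonality turns the expansion into an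
  infinite linear system for the coefficients \<open>A\<close>, coupled by the numbers
  \<open>D = \<integral> head (\<partial>\<^sub>t foot)\<close>; the matrices \<open>M\<close> remove the diagonal blocks of \<open>D\<close>, and they are
  invertible because solutions of a linear system with locally bounded coefficients that vanish at
  some time vanish identically. For \<open>n \<noteq> m\<close>, differentiating the eigenvalue equation in time and
  integrating by parts gives \<open>(\<lambda>\<^sub>n - \<lambda>\<^sub>m) D = Ldot\<close>. All of this is carried out for the
  eigenfunctions \<open>u\<close>, where the factors \<open>exp (\<plusminus> \<beta> V / 2)\<close> have cancelled, so that only products of
  rapidly decaying functions are integrated. Finally, integrating \<open>u\<^sub>0 H u\<^sub>0 = 0\<close> by parts
  shows \<open>\<nabla>u\<^sub>0 + (\<beta> / 2) u\<^sub>0 \<nabla>V = 0\<close>, whence the integrand of \<open>Ldot\<close> for \<open>n = 0\<close> is a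
  divergence and \<open>C\<^sub>0\<close> is constant.\<close>

section \<open>Calculus of \<open>C\<^sup>k\<close> functions\<close>

text \<open>The diagonal blocks of \<open>D\<close> contain a symmetric part from the time
  derivative of the potential, so \<open>M\<close> is not orthogonal in general. Its invertibility
  comes from a Gronwall estimate run from a time \<open>T\<close> back to \<open>ti\<close>, where
  \<open>M\<close> is the identity. Off the diagonal, the head state is paired, up to normalisation,
  with w = v - (\<beta> / 2) g W1, the foot derivative without its exponential. The coupling formula
  is then Green's identity for the Hamiltonian applied to f and w; the derivative of the eigenvalue
  and that of the normalisation only contribute multiples of the integral of f g, which is zero. For
  the ground state, \<nu> \<beta> f H f is a sum of squares minus a divergence. Vanishing of the
  squares says that the head state is constant in space, and the coupling vanishes as conservation
  of probability. Two obstacles shape the preparation. Times include the endpoint \<open>ti\<close>,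
  where mixed derivatives are one-sided in time. The integrands also contain derivatives of a
  potential without any growth bound, so decay is measured against arbitrary products of weights,
  which makes the class of decaying functions stable under multiplication by them.\<close>

lemma Ck_on_SucI:
  assumes "\<And>z. z \<in> S \<Longrightarrow> (f has_derivative f' z) (at z within S)" "\<And>v. Ck_on k S (\<lambda>z. f' z v)"
  shows "Ck_on (Suc k) S f"
  using assms by auto

lemma Ck_on_SucE:
  assumes "Ck_on (Suc k) S f"
  obtains f' where "\<And>z. z \<in> S \<Longrightarrow> (f has_derivative f' z) (at z within S)"
    "\<And>v. Ck_on k S (\<lambda>z. f' z v)"
  using assms by auto

text \<open>Unfolding the successor case would expose an existentially quantified derivative;
  \<open>Ck_on_SucI\<close> and \<open>Ck_on_SucE\<close> keep its witness explicit.\<close>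

declare Ck_on.simps(2) [simp del]

lemma Ck_on_cong:
  assumes "Ck_on k S f" "\<And>z. z \<in> S \<Longrightarrow> f z = g z"
  shows "Ck_on k S g"
proof (cases k)
  case 0
  then show ?thesis using assms continuous_on_cong[of S S f g] by simp
next
  case (Suc n)
  obtain f' where f': "\<And>z. z \<in> S \<Longrightarrow> (f has_derivative f' z) (at z within S)"
    "\<And>v. Ck_on n S (\<lambda>z. f' z v)"
    using assms(1) Suc Ck_on_SucE by blast
  have "(g has_derivative f' z) (at z within S)" if "z \<in> S" for z
    by (rule has_derivative_transform[OF that _ f'(1)[OF that]]) (simp add: assms(2))
  then show ?thesis unfolding Suc using f'(2) by (rule Ck_on_SucI)
qed

text \<open>The recursion asks for continuity only after the last derivative, so monotonicity in
  \<open>k\<close> is an induction; its base case is that differentiable functions are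
  continuous.\<close>

lemma Ck_on_SucD:
  assumes "Ck_on (Suc k) S f"
  shows "Ck_on k S f"
  using assms
proof (induction k arbitrary: f)
  case 0
  then show ?case
    by (auto elim!: Ck_on_SucE intro!: has_derivative_continuous simp: continuous_on_eq_continuous_within)
next
  case (Suc k)
  from Suc.prems obtain f' where "\<And>z. z \<in> S \<Longrightarrow> (f has_derivative f' z) (at z within S)"
    "\<And>v. Ck_on (Suc k) S (\<lambda>z. f' z v)" using Ck_on_SucE by blast
  then show ?case using Suc.IH by (intro Ck_on_SucI[where f' = f']) auto
qed

lemma Ck_on_const: "Ck_on k S (\<lambda>z. c)"
  by (induction k arbitrary: c) (auto intro!: Ck_on_SucI derivative_eq_intros)

lemma Ck_on_bounded_linear:
  assumes "bounded_linear L"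
  shows "Ck_on k S L"
proof (cases k)
  case 0
  then show ?thesis using assms by (simp add: linear_continuous_on)
next
  case (Suc n)
  show ?thesis unfolding Suc
    by (rule Ck_on_SucI[where f' = "\<lambda>_. L"])
      (use assms in \<open>auto intro: bounded_linear_imp_has_derivative Ck_on_const\<close>)
qed

lemma Ck_on_add:
  assumes "Ck_on k S f" "Ck_on k S g"
  shows "Ck_on k S (\<lambda>z. f z + g z)"
  using assms
proof (induction k arbitrary: f g)
  case 0
  then show ?case by (simp add: continuous_on_add)
next
  case (Suc k)
  obtain f' where f': "\<And>z. z \<in> S \<Longrightarrow> (f has_derivative f' z) (at z within S)"
    "\<And>v. Ck_on k S (\<lambda>z. f' z v)" using Ck_on_SucE[OF Suc.prems(1)] by blast
  obtain g' where g': "\<And>z. z \<in> S \<Longrightarrow> (g has_derivative g' z) (at z within S)"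
    "\<And>v. Ck_on k S (\<lambda>z. g' z v)" using Ck_on_SucE[OF Suc.prems(2)] by blast
  show ?case
    by (rule Ck_on_SucI[where f' = "\<lambda>z v. f' z v + g' z v"])
      (use f' g' Suc.IH in \<open>auto intro: has_derivative_add\<close>)
qed

lemma Ck_on_sum:
  assumes "\<And>i. i \<in> A \<Longrightarrow> Ck_on k S (f i)"
  shows "Ck_on k S (\<lambda>z. \<Sum>i\<in>A. f i z)"
  using assms by (induction A rule: infinite_finite_induct) (auto intro: Ck_on_const Ck_on_add)

text \<open>Each term of the product rule leaves one factor undifferentiated;
  \<open>Ck_on_SucD\<close> supplies class \<open>k\<close> for that factor before the induction
  hypothesis is applied.\<close>

lemma Ck_on_scaleR:
  assumes "Ck_on k S f" "Ck_on k S g"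
  shows "Ck_on k S (\<lambda>z. f z *\<^sub>R g z)"
  using assms
proof (induction k arbitrary: f g)
  case 0
  then show ?case by (simp add: continuous_on_scaleR)
next
  case (Suc k)
  obtain f' where f': "\<And>z. z \<in> S \<Longrightarrow> (f has_derivative f' z) (at z within S)"
    "\<And>v. Ck_on k S (\<lambda>z. f' z v)" using Ck_on_SucE[OF Suc.prems(1)] by blast
  obtain g' where g': "\<And>z. z \<in> S \<Longrightarrow> (g has_derivative g' z) (at z within S)"
    "\<And>v. Ck_on k S (\<lambda>z. g' z v)" using Ck_on_SucE[OF Suc.prems(2)] by blast
  have "Ck_on k S f" "Ck_on k S g" using Suc.prems by (auto intro: Ck_on_SucD)
  then show ?case
    by (intro Ck_on_SucI[where f' = "\<lambda>z v. f z *\<^sub>R g' z v + f' z v *\<^sub>R g z"]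
        has_derivative_scaleR Ck_on_add Suc.IH f' g')
qed

lemma Ck_on_linear_compose:
  assumes "bounded_linear L" "Ck_on k S f"
  shows "Ck_on k S (\<lambda>z. L (f z))"
  using assms(2)
proof (induction k arbitrary: f)
  case 0
  then show ?case using assms(1) by (auto intro: bounded_linear.continuous_on)
next
  case (Suc k)
  obtain f' where f': "\<And>z. z \<in> S \<Longrightarrow> (f has_derivative f' z) (at z within S)"
    "\<And>v. Ck_on k S (\<lambda>z. f' z v)" using Ck_on_SucE[OF Suc.prems] by blast
  show ?case
    by (rule Ck_on_SucI[where f' = "\<lambda>z v. L (f' z v)"])
      (use f' Suc.IH assms(1) in \<open>auto intro: bounded_linear.has_derivative\<close>)
qed

text \<open>In the chain rule \<open>f' (\<phi> z) (p z v)\<close> the variable \<open>z\<close>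
  enters through the base point and through the direction. Expanding the direction in the basis
  leaves scalar factors times \<open>f' (\<phi> z) e\<close> with \<open>e\<close> fixed, and the
  induction hypothesis applies to each of these.\<close>

lemma Ck_on_compose:
  assumes "Ck_on k S \<phi>" "\<phi> ` S \<subseteq> T" "Ck_on k T f"
  shows "Ck_on k S (\<lambda>z. f (\<phi> z))"
  using assms
proof (induction k arbitrary: f)
  case 0
  then show ?case by (auto intro: continuous_on_compose2)
next
  case (Suc k)
  obtain p where p: "\<And>z. z \<in> S \<Longrightarrow> (\<phi> has_derivative p z) (at z within S)"
    "\<And>v. Ck_on k S (\<lambda>z. p z v)" using Ck_on_SucE[OF Suc.prems(1)] by blast
  obtain f' where f': "\<And>z. z \<in> T \<Longrightarrow> (f has_derivative f' z) (at z within T)"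
    "\<And>v. Ck_on k T (\<lambda>z. f' z v)" using Ck_on_SucE[OF Suc.prems(3)] by blast
  show ?case
  proof (rule Ck_on_SucI[where f' = "\<lambda>z v. f' (\<phi> z) (p z v)"])
    fix z assume z: "z \<in> S"
    have "((f \<circ> \<phi>) has_derivative f' (\<phi> z) \<circ> p z) (at z within S)"
      using Suc.prems(2) z by (intro diff_chain_within p has_derivative_subset[OF f'(1)]) auto
    then show "((\<lambda>z. f (\<phi> z)) has_derivative (\<lambda>v. f' (\<phi> z) (p z v))) (at z within S)"
      by (simp add: o_def)
  next
    fix v
    have "Ck_on k S (\<lambda>z. \<Sum>e\<in>Basis. inner (p z v) e *\<^sub>R f' (\<phi> z) e)"
      by (intro Ck_on_sum Ck_on_scaleR Suc.IH Ck_on_linear_compose[of "\<lambda>y. inner y e" for e]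
          bounded_linear_inner_left p f') (use Suc.prems in \<open>auto intro: Ck_on_SucD\<close>)
    moreover have "(\<Sum>e\<in>Basis. inner (p z v) e *\<^sub>R f' (\<phi> z) e) = f' (\<phi> z) (p z v)" if "z \<in> S" for z
    proof -
      have "bounded_linear (f' (\<phi> z))"
        using f'(1) Suc.prems(2) that by (intro has_derivative_bounded_linear) auto
      then have "linear (f' (\<phi> z))" by (rule bounded_linear.linear)
      then have "f' (\<phi> z) (\<Sum>e\<in>Basis. inner (p z v) e *\<^sub>R e) = (\<Sum>e\<in>Basis. inner (p z v) e *\<^sub>R f' (\<phi> z) e)"
        by (simp add: linear_sum linear_cmul)
      then show ?thesis by (simp add: euclidean_representation)
    qed
    ultimately show "Ck_on k S (\<lambda>z. f' (\<phi> z) (p z v))"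
      by (rule Ck_on_cong)
  qed
qed

section \<open>Closure properties of smooth functions\<close>

lemma smooth_on_const: "smooth_on S (\<lambda>z. c)"
  by (simp add: smooth_on_def Ck_on_const)

lemma smooth_on_add: "smooth_on S f \<Longrightarrow> smooth_on S g \<Longrightarrow> smooth_on S (\<lambda>z. f z + g z)"
  by (simp add: smooth_on_def Ck_on_add)

lemma smooth_on_sum: "(\<And>i. i \<in> A \<Longrightarrow> smooth_on S (f i)) \<Longrightarrow> smooth_on S (\<lambda>z. \<Sum>i\<in>A. f i z)"
  by (simp add: smooth_on_def Ck_on_sum)

lemma smooth_on_mult:
  fixes f g :: "'a::euclidean_space \<Rightarrow> real"
  shows "smooth_on S f \<Longrightarrow> smooth_on S g \<Longrightarrow> smooth_on S (\<lambda>z. f z * g z)"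
  using Ck_on_scaleR[of _ S f g] by (simp add: smooth_on_def)

lemma smooth_on_compose:
  assumes "smooth_on S \<phi>" "\<phi> ` S \<subseteq> T" "smooth_on T f"
  shows "smooth_on S (\<lambda>z. f (\<phi> z))"
  using assms Ck_on_compose unfolding smooth_on_def by blast

lemma smooth_on_bounded_linear: "bounded_linear L \<Longrightarrow> smooth_on S L"
  by (simp add: smooth_on_def Ck_on_bounded_linear)

lemma smooth_on_linear_compose:
  "bounded_linear L \<Longrightarrow> smooth_on S f \<Longrightarrow> smooth_on S (\<lambda>z. L (f z))"
  by (simp add: smooth_on_def Ck_on_linear_compose)

text \<open>Embedding both components linearly and adding them reduces pairing to sums and linear
  maps.\<close>

lemma smooth_on_Pair:
  fixes f :: "'c::euclidean_space \<Rightarrow> 'a::euclidean_space" and g :: "'c \<Rightarrow> 'b::euclidean_space"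
  assumes "smooth_on S f" "smooth_on S g"
  shows "smooth_on S (\<lambda>z. (f z, g z))"
proof -
  have "smooth_on S (\<lambda>z. (f z, 0::'b) + (0::'a, g z))"
    by (intro smooth_on_add smooth_on_linear_compose[of "\<lambda>v. (v, 0::'b)"]
        smooth_on_linear_compose[of "\<lambda>v. (0::'a, v)"] assms
        bounded_linear_Pair bounded_linear_ident bounded_linear_zero)
  then show ?thesis by simp
qed

lemma smooth_on_exp: "smooth_on S (exp :: real \<Rightarrow> real)"
proof -
  \<comment> \<open>The free factor \<open>c\<close> makes the claim stable under differentiation:
    the derivative in direction \<open>v\<close> has the same form with factor
    \<open>c * v\<close>.\<close>
  have "Ck_on k S (\<lambda>z. c * exp z)" for k and c :: real
  proof (induction k arbitrary: c)
    case 0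
    then show ?case by (auto intro!: continuous_intros)
  next
    case (Suc k)
    show ?case
      by (rule Ck_on_SucI[where f' = "\<lambda>z v. (c * v) * exp z"])
        (use Suc.IH in \<open>auto intro!: derivative_eq_intros\<close>)
  qed
  from this[of _ 1] show ?thesis by (simp add: smooth_on_def)
qed

section \<open>Partial and time derivatives\<close>

lemma pd_eqI: "((\<lambda>h. f (x + h *\<^sub>R b)) has_real_derivative d) (at 0) \<Longrightarrow> pd b f x = d"
  unfolding pd_def by (rule DERIV_imp_deriv)

lemma has_derivative_directional:
  fixes f :: "'a::real_normed_vector \<Rightarrow> real"
  assumes "(f has_derivative D) (at (x + h *\<^sub>R b))"
  shows "((\<lambda>h. f (x + h *\<^sub>R b)) has_real_derivative D b) (at h)"
proof -
  have "((\<lambda>h. x + h *\<^sub>R b) has_derivative (\<lambda>k. k *\<^sub>R b)) (at h)"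
    by (auto intro!: derivative_eq_intros)
  from diff_chain_at[OF this, of f D] assms
  have "((\<lambda>h. f (x + h *\<^sub>R b)) has_derivative (\<lambda>k. D (k *\<^sub>R b))) (at h)"
    by (simp add: o_def)
  moreover have "(\<lambda>k. D (k *\<^sub>R b)) = (*) (D b)"
    using has_derivative_bounded_linear[OF assms]
    by (auto simp: fun_eq_iff linear_cmul bounded_linear.linear)
  ultimately show ?thesis by (simp add: has_field_derivative_def)
qed

lemma pd_eq_derivative: "(f has_derivative D) (at x) \<Longrightarrow> pd b f x = D b"
  using has_derivative_directional[of f D x 0 b] by (intro pd_eqI) simp

lemma smooth_on_has_derivative:
  assumes "smooth_on S f"
  shows "\<exists>f'. (\<forall>z\<in>S. (f has_derivative f' z) (at z within S)) \<and> (\<forall>v. Ck_on k S (\<lambda>z. f' z v))"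
proof -
  have "Ck_on (Suc k) S f" using assms unfolding smooth_on_def by (rule spec)
  then show ?thesis by (simp only: Ck_on.simps)
qed

lemma smooth_on_imp_continuous_on: "smooth_on S f \<Longrightarrow> continuous_on S f"
  unfolding smooth_on_def by (drule spec[of _ 0]) simp

lemma smooth_on_has_pd:
  assumes "smooth_on UNIV f"
  shows "((\<lambda>h. f (x + h *\<^sub>R b)) has_real_derivative pd b f (x + h *\<^sub>R b)) (at h)"
proof -
  obtain f' where f': "\<And>z. (f has_derivative f' z) (at z)"
    using smooth_on_has_derivative[OF assms] by blast
  show ?thesis
    using has_derivative_directional[OF f'] by (simp add: pd_eq_derivative[OF f'])
qed

lemma smooth_on_has_pd_0:
  assumes "smooth_on UNIV f"
  shows "((\<lambda>h. f (x + h *\<^sub>R b)) has_real_derivative pd b f x) (at 0)"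
  using smooth_on_has_pd[OF assms, of x b 0] by simp

text \<open>Smoothness yields a possibly different derivative for every order \<open>k\<close>; all
  of them agree with \<open>pd b f\<close>, so this one function has every order.\<close>

lemma smooth_on_pd:
  assumes "smooth_on UNIV f"
  shows "smooth_on UNIV (pd b f)"
  unfolding smooth_on_def
proof
  fix k
  obtain f' where f': "\<And>z. (f has_derivative f' z) (at z)" "\<And>v. Ck_on k UNIV (\<lambda>z. f' z v)"
    using smooth_on_has_derivative[OF assms, of k] by blast
  show "Ck_on k UNIV (pd b f)"
    by (rule Ck_on_cong[OF f'(2)[of b]]) (simp add: pd_eq_derivative[OF f'(1)])
qed

lemma pd_const: "pd b (\<lambda>y. c) x = 0"
  by (rule pd_eqI) (auto intro!: derivative_eq_intros)

lemma pd_add: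
  "smooth_on UNIV f \<Longrightarrow> smooth_on UNIV g \<Longrightarrow> pd b (\<lambda>y. f y + g y) x = pd b f x + pd b g x"
  by (rule pd_eqI) (auto intro!: derivative_eq_intros smooth_on_has_pd_0)

lemma pd_mult:
  assumes "smooth_on UNIV f" "smooth_on UNIV g"
  shows "pd b (\<lambda>y. f y * g y) x = pd b f x * g x + f x * pd b g x"
  by (rule pd_eqI)
    (auto intro!: derivative_eq_intros smooth_on_has_pd_0[OF assms(1)] smooth_on_has_pd_0[OF assms(2)])

lemma pd_cmult:
  "smooth_on UNIV f \<Longrightarrow> pd b (\<lambda>y. c * f y) x = c * pd b f x"
  by (simp add: pd_mult smooth_on_const pd_const)

lemma pd_sum:
  assumes "\<And>i. i \<in> A \<Longrightarrow> smooth_on UNIV (f i)"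
  shows "pd b (\<lambda>y. \<Sum>i\<in>A. f i y) x = (\<Sum>i\<in>A. pd b (f i) x)"
  by (rule pd_eqI) (auto intro!: derivative_eq_intros smooth_on_has_pd_0 assms)

lemma pd_exp:
  assumes "smooth_on UNIV f"
  shows "pd b (\<lambda>y. exp (f y)) x = pd b f x * exp (f x)"
  by (rule pd_eqI) (auto intro!: derivative_eq_intros smooth_on_has_pd_0[OF assms])

lemma smooth_on_exp_compose: "smooth_on S f \<Longrightarrow> smooth_on S (\<lambda>z. exp (f z :: real))"
  using smooth_on_compose[of S f UNIV exp] smooth_on_exp by auto

text \<open>Nontriviality of this filter is what makes one-sided time derivatives unique, including
  at \<open>ti\<close>; \<open>dt_eqI\<close> rests on it.\<close>

lemma at_within_atLeast_neq_bot: "(ti::real) \<le> t \<Longrightarrow> at t within {ti..} \<noteq> bot"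
proof -
  assume "ti \<le> t"
  then have "at_right t \<le> at t within {ti..}" by (intro at_le) auto
  then show ?thesis using trivial_limit_at_right_real bot.extremum_uniqueI by metis
qed

lemma dt_eqI:
  assumes "(f has_real_derivative d) (at t within {ti..})" "ti \<le> t"
  shows "dt ti f t = d"
  unfolding dt_def
  using assms by (intro vector_derivative_within at_within_atLeast_neq_bot)
    (auto simp: has_real_derivative_iff_has_vector_derivative)

text \<open>Chain rule along the two coordinate slices. The spatial slice lies entirely in the
  half-space even for \<open>t = ti\<close>, so the spatial derivative is two-sided, while the time
  derivative stays within \<open>{ti..}\<close>.\<close>

lemma has_derivative_spacetime:
  assumes "(case_prod F has_derivative D) (at (x, t) within UNIV \<times> {ti..})" "ti \<le> t"
  shows "((\<lambda>y. F y t) has_derivative (\<lambda>v. D (v, 0))) (at x)"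
    and "(F x has_real_derivative D (0, 1)) (at t within {ti..})"
proof -
  have "((case_prod F \<circ> (\<lambda>y. (y, t))) has_derivative D \<circ> (\<lambda>v. (v, 0))) (at x within UNIV)"
    by (intro diff_chain_within has_derivative_subset[OF assms(1)])
      (use assms(2) in \<open>auto intro!: derivative_eq_intros\<close>)
  then show "((\<lambda>y. F y t) has_derivative (\<lambda>v. D (v, 0))) (at x)"
    by (simp add: o_def)
  have "((case_prod F \<circ> (\<lambda>s. (x, s))) has_derivative D \<circ> (\<lambda>s. (0, s))) (at t within {ti..})"
    by (intro diff_chain_within has_derivative_subset[OF assms(1)])
      (auto intro!: derivative_eq_intros)
  moreover have "D \<circ> (\<lambda>s. (0, s)) = (*) (D (0, 1))"
  proof
    fix s :: real
    have "D (s *\<^sub>R (0, 1)) = s *\<^sub>R D (0, 1)"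
      using has_derivative_bounded_linear[OF assms(1)] by (intro linear_cmul bounded_linear.linear)
    then show "(D \<circ> (\<lambda>s. (0, s))) s = D (0, 1) * s" by simp
  qed
  ultimately show "(F x has_real_derivative D (0, 1)) (at t within {ti..})"
    by (simp add: o_def has_field_derivative_def)
qed

lemma smooth_on_slice:
  assumes "smooth_on (UNIV \<times> {ti..}) (case_prod F)" "ti \<le> t"
  shows "smooth_on UNIV (\<lambda>x. F x t)"
  using smooth_on_compose[of UNIV "\<lambda>x. (x, t)" "UNIV \<times> {ti..}" "case_prod F"]
    smooth_on_Pair[OF smooth_on_bounded_linear[OF bounded_linear_ident] smooth_on_const] assms
  by auto

lemma smooth_on_has_dt:
  assumes "smooth_on (UNIV \<times> {ti..}) (case_prod F)" "ti \<le> t"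
  shows "(F x has_real_derivative dt ti (F x) t) (at t within {ti..})"
proof -
  obtain f' where f': "\<And>z. z \<in> UNIV \<times> {ti..} \<Longrightarrow> (case_prod F has_derivative f' z) (at z within UNIV \<times> {ti..})"
    using smooth_on_has_derivative[OF assms(1)] by blast
  have "(F x has_real_derivative f' (x, t) (0, 1)) (at t within {ti..})"
    using assms(2) by (intro has_derivative_spacetime(2)[OF f']) auto
  with dt_eqI[OF this assms(2)] show ?thesis by simp
qed

lemma smooth_on_spacetime_pd:
  fixes ti :: real
  assumes "smooth_on (UNIV \<times> {ti..}) (case_prod F)"
  shows "smooth_on (UNIV \<times> {ti..}) (\<lambda>(x, t). pd b (\<lambda>y. F y t) x)"
  unfolding smooth_on_def
proof
  fix k
  obtain f' where f': "\<And>z. z \<in> UNIV \<times> {ti..} \<Longrightarrow> (case_prod F has_derivative f' z) (at z within UNIV \<times> {ti..})"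
    "\<And>v. Ck_on k (UNIV \<times> {ti..}) (\<lambda>z. f' z v)"
    using smooth_on_has_derivative[OF assms, of k] by blast
  show "Ck_on k (UNIV \<times> {ti..}) (\<lambda>(x, t). pd b (\<lambda>y. F y t) x)"
  proof (rule Ck_on_cong[OF f'(2)[of "(b, 0)"]], clarify)
    fix x t assume "ti \<le> (t::real)"
    then show "f' (x, t) (b, 0) = pd b (\<lambda>y. F y t) x"
      using pd_eq_derivative[OF has_derivative_spacetime(1)[OF f'(1)[of "(x, t)"]]] by simp
  qed
qed

lemma smooth_on_spacetime_dt:
  assumes "smooth_on (UNIV \<times> {ti..}) (case_prod F)"
  shows "smooth_on (UNIV \<times> {ti..}) (\<lambda>(x, t). dt ti (F x) t)"
  unfolding smooth_on_def
proof
  fix k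
  obtain f' where f': "\<And>z. z \<in> UNIV \<times> {ti..} \<Longrightarrow> (case_prod F has_derivative f' z) (at z within UNIV \<times> {ti..})"
    "\<And>v. Ck_on k (UNIV \<times> {ti..}) (\<lambda>z. f' z v)"
    using smooth_on_has_derivative[OF assms, of k] by blast
  show "Ck_on k (UNIV \<times> {ti..}) (\<lambda>(x, t). dt ti (F x) t)"
  proof (rule Ck_on_cong[OF f'(2)[of "(0, 1)"]], clarify)
    fix x t assume "ti \<le> (t::real)"
    then show "f' (x, t) (0, 1) = dt ti (F x) t"
      using dt_eqI[OF has_derivative_spacetime(2)[OF f'(1)[of "(x, t)"]]] by simp
  qed
qed

text \<open>Differentiation of integrals takes place on compact intervals. A derivative at
  \<open>t\<close> only sees a neighbourhood of \<open>t\<close>, and the right end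
  \<open>t + 1\<close> is an arbitrary later time.\<close>

lemma has_real_derivative_Icc_imp_Ici:
  fixes f :: "real \<Rightarrow> real"
  assumes "(f has_real_derivative d) (at t within {ti..t + 1})"
  shows "(f has_real_derivative d) (at t within {ti..})"
proof -
  have "at t within {ti..t + 1} = at t within {ti..}"
    by (rule at_within_nhd[of _ "{t - 1<..<t + 1}"]) auto
  with assms show ?thesis by simp
qed

text \<open>At \<open>t = ti\<close> only one-sided time derivatives exist; writing \<open>F\<close> as the time integral of its
  time derivative and differentiating under the integral covers this case.\<close>

lemma dt_pd_commute:
  assumes F: "smooth_on (UNIV \<times> {ti..}) (case_prod F)" and t: "ti \<le> t"
  shows "((\<lambda>s. pd b (\<lambda>y. F y s) x) has_real_derivative pd b (\<lambda>y. dt ti (F y) t) x) (at t within {ti..})"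
proof -
  define G where "G = (\<lambda>h s. dt ti (F (x + h *\<^sub>R b)) s)"
  define Q where "Q = (\<lambda>h s. pd b (\<lambda>y. dt ti (F y) s) (x + h *\<^sub>R b))"
  \<comment> \<open>Joint continuity in the displacement and in time is the hypothesis of Leibniz's
    rule, although only \<open>Q 0\<close> appears in the result.\<close>
  have contQ: "continuous_on (UNIV \<times> {ti..}) (\<lambda>(h, s). Q h s)"
  proof -
    have "continuous_on (UNIV \<times> {ti..}) (\<lambda>(x, t). pd b (\<lambda>y. dt ti (F y) t) x)"
      by (intro smooth_on_imp_continuous_on smooth_on_spacetime_pd smooth_on_spacetime_dt F)
    from continuous_on_compose2[OF this, of "UNIV \<times> {ti..}" "\<lambda>z. (x + fst z *\<^sub>R b, snd z)"]
    have "continuous_on (UNIV \<times> {ti..}) (\<lambda>z. pd b (\<lambda>y. dt ti (F y) (snd z)) (x + fst z *\<^sub>R b))"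
      by (force intro!: continuous_intros)
    then show ?thesis by (simp add: Q_def case_prod_unfold)
  qed
  have contG: "continuous_on {ti..s} (G h)" for h s
  proof -
    have "continuous_on (UNIV \<times> {ti..}) (\<lambda>(x, t). dt ti (F x) t)"
      by (intro smooth_on_imp_continuous_on smooth_on_spacetime_dt F)
    moreover have "continuous_on {ti..s} (\<lambda>s. (x + h *\<^sub>R b, s))" by (intro continuous_intros)
    ultimately have "continuous_on {ti..s} (\<lambda>s. case (x + h *\<^sub>R b, s) of (x, t) \<Rightarrow> dt ti (F x) t)"
      by (rule continuous_on_compose2) auto
    then show ?thesis by (simp add: G_def)
  qed
  have ftc: "F (x + h *\<^sub>R b) s = F (x + h *\<^sub>R b) ti + integral {ti..s} (G h)" if "ti \<le> s" for h s
  proof -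
    have "(G h has_integral (F (x + h *\<^sub>R b) s - F (x + h *\<^sub>R b) ti)) {ti..s}"
      unfolding G_def using that
      by (intro fundamental_theorem_of_calculus)
        (auto intro!: DERIV_subset[where s = "{ti..}"] smooth_on_has_dt F
          simp flip: has_real_derivative_iff_has_vector_derivative)
    then show ?thesis by (simp add: integral_unique)
  qed
  have pd_int: "pd b (\<lambda>y. F y s) x = pd b (\<lambda>y. F y ti) x + integral {ti..s} (Q 0)" if s: "ti \<le> s" for s
  proof (rule pd_eqI)
    have "((\<lambda>h. integral (cbox ti s) (G h)) has_real_derivative integral (cbox ti s) (Q 0)) (at 0 within UNIV)"
    proof (rule leibniz_rule_field_derivative)
      show "((\<lambda>x. G x t) has_real_derivative Q h t) (at h within UNIV)" if "t \<in> cbox ti s" for h t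
        unfolding G_def Q_def using that
        by (intro smooth_on_has_pd smooth_on_slice[of ti "\<lambda>y. dt ti (F y)"] smooth_on_spacetime_dt F) auto
      show "continuous_on (UNIV \<times> cbox ti s) (\<lambda>(x, t). Q x t)"
        by (rule continuous_on_subset[OF contQ]) auto
    qed (use contG in \<open>auto intro: integrable_continuous_real\<close>)
    moreover have "((\<lambda>h. F (x + h *\<^sub>R b) ti) has_real_derivative pd b (\<lambda>y. F y ti) x) (at 0)"
      by (intro smooth_on_has_pd_0 smooth_on_slice[OF F]) simp
    ultimately show "((\<lambda>h. F (x + h *\<^sub>R b) s) has_real_derivative
        pd b (\<lambda>y. F y ti) x + integral {ti..s} (Q 0)) (at 0)"
      unfolding ftc[OF s] by (auto intro!: derivative_eq_intros)
  qed
  have "continuous_on {ti..t + 1} (Q 0)"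
  proof -
    have "continuous_on {ti..t + 1} (\<lambda>s. (0::real, s))" by (intro continuous_intros)
    from continuous_on_compose2[OF contQ this] show ?thesis by (simp add: image_subset_iff)
  qed
  then have "((\<lambda>s. integral {ti..s} (Q 0)) has_real_derivative Q 0 t) (at t within {ti..t + 1})"
    using t by (intro integral_has_real_derivative) auto
  then have "((\<lambda>s. pd b (\<lambda>y. F y ti) x + integral {ti..s} (Q 0)) has_real_derivative 0 + Q 0 t) (at t within {ti..})"
    by (intro DERIV_add DERIV_const has_real_derivative_Icc_imp_Ici)
  then have "((\<lambda>s. pd b (\<lambda>y. F y s) x) has_real_derivative 0 + Q 0 t) (at t within {ti..})"
    by (rule has_field_derivative_transform_within[of _ _ _ _ 1]) (use t pd_int[symmetric] in auto)
  then show ?thesis by (simp add: Q_def)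
qed

section \<open>The operators in coordinates\<close>

lemma grad_inner: "b \<in> Basis \<Longrightarrow> inner (grad f x) b = pd b f x"
  by (simp add: grad_def inner_sum_left inner_Basis if_distrib sum.delta cong: if_cong)

lemma laplacian_eq: "laplacian f x = (\<Sum>b\<in>Basis. pd b (pd b f) x)"
  unfolding laplacian_def divergence_def
  by (rule sum.cong) (simp_all add: grad_inner)

lemma norm_grad_squared: "(norm (grad f x))\<^sup>2 = (\<Sum>b\<in>Basis. (pd b f x)\<^sup>2)"
  unfolding power2_norm_eq_inner
  by (subst euclidean_inner) (simp add: grad_inner power2_eq_square)

text \<open>A single sum over the basis allows the later identities between second-order expressions
  to be checked one coordinate at a time.\<close>

lemma hamiltonian_eq:
  "hamiltonian \<nu> \<beta> W f x = (\<Sum>b\<in>Basis. - (1 / (\<nu> * \<beta>)) * pd b (pd b f) x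
     - (1 / (2 * \<nu>)) * pd b (pd b W) x * f x + (\<beta> / (4 * \<nu>)) * (pd b W x)\<^sup>2 * f x)"
  unfolding hamiltonian_def laplacian_eq norm_grad_squared
  by (simp add: sum.distrib sum_subtractf sum_distrib_left sum_distrib_right sum_negf)

lemma hamiltonian_sum:
  assumes "\<And>i. i \<in> A \<Longrightarrow> smooth_on UNIV (f i)"
  shows "hamiltonian \<nu> \<beta> W (\<lambda>y. \<Sum>i\<in>A. c i * f i y) x = (\<Sum>i\<in>A. c i * hamiltonian \<nu> \<beta> W (f i) x)"
proof -
  have 1: "pd b (\<lambda>y. \<Sum>i\<in>A. c i * f i y) = (\<lambda>y. \<Sum>i\<in>A. c i * pd b (f i) y)" for b
    using assms by (auto simp: fun_eq_iff pd_sum pd_cmult smooth_on_mult smooth_on_const intro!: sum.cong)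
  have 2: "pd b (\<lambda>y. \<Sum>i\<in>A. c i * pd b (f i) y) x = (\<Sum>i\<in>A. c i * pd b (pd b (f i)) x)" for b
    using assms by (auto simp: pd_sum pd_cmult smooth_on_mult smooth_on_const smooth_on_pd intro!: sum.cong)
  have "laplacian (\<lambda>y. \<Sum>i\<in>A. c i * f i y) x = (\<Sum>i\<in>A. c i * laplacian (f i) x)"
    unfolding laplacian_eq 1 2 sum_distrib_left by (rule sum.swap)
  then show ?thesis
    unfolding hamiltonian_def
    by (simp add: sum.distrib sum_subtractf sum_distrib_left sum_negf sum_divide_distrib algebra_simps)
qed

lemma fokker_planck_eq:
  assumes "smooth_on UNIV f" "smooth_on UNIV W"
  shows "fokker_planck \<nu> \<beta> W f x = (\<Sum>b\<in>Basis. (1 / (\<nu> * \<beta>)) * pd b (pd b f) x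
     + (1 / \<nu>) * (pd b f x * pd b W x + f x * pd b (pd b W) x))"
  unfolding fokker_planck_def divergence_def
proof (rule sum.cong)
  fix b :: 'a assume b: "b \<in> Basis"
  have "(\<lambda>y. inner ((1 / (\<nu> * \<beta>)) *\<^sub>R grad f y + (1 / \<nu>) *\<^sub>R f y *\<^sub>R grad W y) b)
    = (\<lambda>y. (1 / (\<nu> * \<beta>)) * pd b f y + (1 / \<nu>) * (f y * pd b W y))"
    using b by (simp add: inner_add_left grad_inner)
  then show "pd b (\<lambda>y. inner ((1 / (\<nu> * \<beta>)) *\<^sub>R grad f y + (1 / \<nu>) *\<^sub>R f y *\<^sub>R grad W y) b) x
    = (1 / (\<nu> * \<beta>)) * pd b (pd b f) x + (1 / \<nu>) * (pd b f x * pd b W x + f x * pd b (pd b W) x)"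
    using assms by (simp only: pd_add pd_cmult pd_mult smooth_on_pd smooth_on_mult smooth_on_const)
qed simp

lemma fokker_planck_dt_eq:
  assumes "smooth_on UNIV f" "smooth_on UNIV W"
  shows "fokker_planck_dt \<nu> W f x =
    (1 / \<nu>) * (\<Sum>b\<in>Basis. pd b f x * pd b W x + f x * pd b (pd b W) x)"
  unfolding fokker_planck_dt_def divergence_def
proof (intro arg_cong2[where f = "(*)"] refl sum.cong)
  fix b :: 'a assume b: "b \<in> Basis"
  have "(\<lambda>y. inner (f y *\<^sub>R grad W y) b) = (\<lambda>y. f y * pd b W y)"
    using b by (simp add: grad_inner)
  then show "pd b (\<lambda>y. inner (f y *\<^sub>R grad W y) b) x = pd b f x * pd b W x + f x * pd b (pd b W) x"
    using assms by (simp only: pd_mult smooth_on_pd)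
qed

section \<open>Conjugation of the operators by exp (- \<beta> W / 2)\<close>

lemma pd_gauge:
  assumes "smooth_on UNIV f" "smooth_on UNIV W"
  shows "pd b (\<lambda>y. exp (- \<beta> * W y / 2) * f y) x =
    exp (- \<beta> * W x / 2) * (pd b f x + - \<beta> / 2 * (pd b W x * f x))"
proof -
  have e: "smooth_on UNIV (\<lambda>y. (- \<beta> / 2) * W y)"
    by (intro smooth_on_mult smooth_on_const assms)
  have "pd b (\<lambda>y. exp ((- \<beta> / 2) * W y) * f y) x =
    exp ((- \<beta> / 2) * W x) * (pd b f x + - \<beta> / 2 * (pd b W x * f x))"
    using assms e by (simp only: pd_mult smooth_on_exp_compose pd_exp pd_cmult) (simp add: algebra_simps)
  then show ?thesis by simp
qed

lemma smooth_on_gauge: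
  fixes f W :: "'a::euclidean_space \<Rightarrow> real"
  assumes "smooth_on S f" "smooth_on S W"
  shows "smooth_on S (\<lambda>y. exp (- \<beta> * W y / 2) * f y)"
proof -
  have "smooth_on S (\<lambda>y. exp ((- \<beta> / 2) * W y) * f y)"
    by (intro smooth_on_mult smooth_on_exp_compose smooth_on_const assms)
  then show ?thesis by simp
qed

text \<open>Conjugation replaces each partial derivative by itself minus \<beta> / 2 times that of
  \<open>W\<close>. Doing this twice, the first-order terms of the diffusion part cancel against
  those of the drift, and a Schroedinger operator remains.\<close>

lemma fokker_planck_gauge:
  assumes f: "smooth_on UNIV f" and W: "smooth_on UNIV W" and "\<nu> > 0" "\<beta> > 0"
  shows "fokker_planck \<nu> \<beta> W (\<lambda>y. exp (- \<beta> * W y / 2) * f y) x =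
    - (exp (- \<beta> * W x / 2) * hamiltonian \<nu> \<beta> W f x)"
proof -
  have 1: "pd b (pd b (\<lambda>y. exp (- \<beta> * W y / 2) * f y)) x = exp (- \<beta> * W x / 2) *
    (pd b (pd b f) x - \<beta> * pd b W x * pd b f x - \<beta> / 2 * pd b (pd b W) x * f x
      + \<beta>\<^sup>2 / 4 * (pd b W x)\<^sup>2 * f x)" for b
  proof -
    have "pd b (\<lambda>y. exp (- \<beta> * W y / 2) * f y) =
      (\<lambda>y. exp (- \<beta> * W y / 2) * (pd b f y + - \<beta> / 2 * (pd b W y * f y)))"
      using pd_gauge[OF f W] by blast
    moreover have "smooth_on UNIV (\<lambda>y. pd b f y + - \<beta> / 2 * (pd b W y * f y))"
      by (intro smooth_on_add smooth_on_mult smooth_on_pd smooth_on_const f W)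
    moreover have "pd b (\<lambda>y. pd b f y + - \<beta> / 2 * (pd b W y * f y)) x =
       pd b (pd b f) x + - \<beta> / 2 * (pd b (pd b W) x * f x + pd b W x * pd b f x)"
      using f W by (simp only: pd_add pd_cmult pd_mult smooth_on_pd smooth_on_mult smooth_on_const)
    ultimately show ?thesis
      by (simp only: pd_gauge W) (simp add: field_simps power2_eq_square)
  qed
  show ?thesis
    unfolding fokker_planck_eq[OF smooth_on_gauge[OF f W] W] hamiltonian_eq 1 pd_gauge[OF f W]
      sum_distrib_left sum_negf[symmetric]
    by (rule sum.cong) (use assms in \<open>simp_all add: field_simps power2_eq_square\<close>)
qed

section \<open>Rapid decay and integration by parts\<close>

text \<open>Every coordinate satisfies 1 + (x . b)^2 <= (1 + |x|)^2, so a product of one-dimensional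
  Cauchy densities, integrable by factorisation over the coordinates, dominates. Two powers per
  coordinate give the exponent \<open>2 * DIM('x)\<close>.\<close>

lemma integrable_inverse_power_norm:
  "integrable lborel (\<lambda>x::'x::euclidean_space. 1 / (1 + norm x) ^ (2 * DIM('x)))"
proof (rule Bochner_Integration.integrable_bound)
  show "integrable lborel (\<lambda>x::'x. \<Prod>b\<in>Basis. inverse (1 + (inner x b)\<^sup>2))"
  proof (rule integrableI_nonneg)
    have "integrable lborel (\<lambda>x::real. inverse (1 + x\<^sup>2))"
      using integrable_inverse_1_plus_square by (simp add: set_integrable_def einterval_def)
    then have "(\<integral>\<^sup>+x. ennreal (inverse (1 + x\<^sup>2)) \<partial>lborel) < \<infinity>"
      by (subst nn_integral_eq_integral) (auto simp: add_nonneg_nonneg)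
    moreover have "(\<integral>\<^sup>+x. ennreal (\<Prod>b\<in>Basis. inverse (1 + (inner (x::'x) b)\<^sup>2)) \<partial>lborel) =
       (\<Prod>b\<in>(Basis::'x set). \<integral>\<^sup>+x. ennreal (inverse (1 + x\<^sup>2)) \<partial>lborel)"
      by (subst nn_integral_lborel_prod[symmetric]) (auto simp: prod_ennreal add_nonneg_nonneg)
    ultimately show "(\<integral>\<^sup>+x. ennreal (\<Prod>b\<in>Basis. inverse (1 + (inner (x::'x) b)\<^sup>2)) \<partial>lborel) < \<infinity>"
      by (simp add: power_less_top_ennreal)
  qed (auto intro!: prod_nonneg simp: add_nonneg_nonneg)
next
  show "AE x::'x in lborel. norm (1 / (1 + norm x) ^ (2 * DIM('x))) \<le>
      norm (\<Prod>b\<in>Basis. inverse (1 + (inner x b)\<^sup>2))"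
  proof (rule AE_I2)
    fix x :: 'x
    have "(\<Prod>b\<in>(Basis::'x set). inverse ((1 + norm x)\<^sup>2)) \<le> (\<Prod>b\<in>Basis. inverse (1 + (inner x b)\<^sup>2))"
    proof (intro prod_mono conjI le_imp_inverse_le)
      fix b :: 'x assume "b \<in> Basis"
      then have "\<bar>inner x b\<bar> \<le> norm x" by (rule Basis_le_norm)
      then have "(inner x b)\<^sup>2 \<le> (norm x)\<^sup>2" by (metis abs_le_square_iff abs_norm_cancel)
      then show "1 + (inner x b)\<^sup>2 \<le> (1 + norm x)\<^sup>2" using norm_ge_zero[of x] by (simp add: power2_sum add_increasing2)
    qed (auto simp: add_pos_nonneg)
    then show "norm (1 / (1 + norm x) ^ (2 * DIM('x))) \<le>
        norm (\<Prod>b\<in>Basis. inverse (1 + (inner x b)\<^sup>2))"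
      by (simp add: power_mult power_inverse abs_prod inverse_eq_divide power_divide)
  qed
qed measurable

text \<open>In the applications \<open>\<W>\<close> is the jet of the potential at a fixed time.\<close>

definition rapid :: "('x::euclidean_space \<Rightarrow> real) set \<Rightarrow> ('x \<Rightarrow> real) \<Rightarrow> bool" where
  "rapid \<W> f \<longleftrightarrow> continuous_on UNIV f \<and> (\<forall>ws. set ws \<subseteq> \<W> \<longrightarrow>
     (\<forall>k. \<exists>C. \<forall>x. (1 + norm x) ^ k * (\<Prod>w\<leftarrow>ws. \<bar>w x\<bar>) * \<bar>f x\<bar> \<le> C))"

lemma rapidI:
  assumes "continuous_on UNIV f"
    and "\<And>ws k. set ws \<subseteq> \<W> \<Longrightarrow> \<exists>C. \<forall>x. (1 + norm x) ^ k * (\<Prod>w\<leftarrow>ws. \<bar>w x\<bar>) * \<bar>f x\<bar> \<le> C"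
  shows "rapid \<W> f"
  using assms by (simp add: rapid_def)

lemma rapidE:
  assumes "rapid \<W> f" "set ws \<subseteq> \<W>"
  obtains C where "\<And>x. (1 + norm x) ^ k * (\<Prod>w\<leftarrow>ws. \<bar>w x\<bar>) * \<bar>f x\<bar> \<le> C"
  using assms unfolding rapid_def by metis

lemma rapid_continuous: "rapid \<W> f \<Longrightarrow> continuous_on UNIV f"
  by (simp add: rapid_def)

lemma prod_list_abs_nonneg: "0 \<le> (\<Prod>w\<leftarrow>ws. \<bar>w x :: real\<bar>)"
  by (induction ws) auto

text \<open>The extra factor is absorbed by consing \<open>w\<close> onto the list of weights;
  quantifying over lists in \<open>rapid\<close> serves this purpose.\<close>

lemma rapid_mult_weight:
  assumes "rapid \<W> f" "w \<in> \<W>" "continuous_on UNIV w"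
  shows "rapid \<W> (\<lambda>x. f x * w x)"
proof (rule rapidI)
  show "continuous_on UNIV (\<lambda>x. f x * w x)"
    using assms(3) rapid_continuous[OF assms(1)] by (intro continuous_on_mult)
  fix ws k assume "set ws \<subseteq> \<W>"
  with assms(2) have "set (w # ws) \<subseteq> \<W>" by simp
  from rapidE[OF assms(1) this, of k] obtain C where
    "\<And>x. (1 + norm x) ^ k * (\<Prod>w\<leftarrow>w # ws. \<bar>w x\<bar>) * \<bar>f x\<bar> \<le> C" by metis
  then show "\<exists>C. \<forall>x. (1 + norm x) ^ k * (\<Prod>w\<leftarrow>ws. \<bar>w x\<bar>) * \<bar>f x * w x\<bar> \<le> C"
    by (intro exI[of _ C]) (simp add: abs_mult ac_simps)
qed

lemma rapid_mult:
  assumes f: "rapid \<W> f" and g: "rapid \<W> g"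
  shows "rapid \<W> (\<lambda>x. f x * g x)"
proof (rule rapidI)
  show "continuous_on UNIV (\<lambda>x. f x * g x)"
    using assms by (intro continuous_on_mult rapid_continuous)
  fix ws k assume ws: "set ws \<subseteq> \<W>"
  obtain C where C: "\<And>x. (1 + norm x) ^ k * (\<Prod>w\<leftarrow>ws. \<bar>w x\<bar>) * \<bar>f x\<bar> \<le> C"
    using rapidE[OF f ws] by metis
  \<comment> \<open>One factor carries the decay and the weights; from the other only boundedness is
    taken, the case of no weights and power \<open>0\<close>.\<close>
  obtain D where D: "\<And>x. \<bar>g x\<bar> \<le> D"
    using rapidE[OF g, of "[]" 0] by auto
  have "(1 + norm x) ^ k * (\<Prod>w\<leftarrow>ws. \<bar>w x\<bar>) * \<bar>f x\<bar> * \<bar>g x\<bar> \<le> C * D" for x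
  proof (intro mult_mono C D)
    have "0 \<le> (1 + norm x) ^ k * (\<Prod>w\<leftarrow>ws. \<bar>w x\<bar>) * \<bar>f x\<bar>"
      by (intro mult_nonneg_nonneg prod_list_abs_nonneg) auto
    then show "0 \<le> C" using C[of x] by linarith
  qed simp
  then show "\<exists>C. \<forall>x. (1 + norm x) ^ k * (\<Prod>w\<leftarrow>ws. \<bar>w x\<bar>) * \<bar>f x * g x\<bar> \<le> C"
    by (intro exI[of _ "C * D"]) (simp add: abs_mult mult.assoc)
qed

lemma rapid_add:
  assumes f: "rapid \<W> f" and g: "rapid \<W> g"
  shows "rapid \<W> (\<lambda>x. f x + g x)"
proof (rule rapidI)
  show "continuous_on UNIV (\<lambda>x. f x + g x)"
    using assms by (intro continuous_on_add rapid_continuous)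
  fix ws k assume ws: "set ws \<subseteq> \<W>"
  obtain C where C: "\<And>x. (1 + norm x) ^ k * (\<Prod>w\<leftarrow>ws. \<bar>w x\<bar>) * \<bar>f x\<bar> \<le> C"
    using rapidE[OF f ws] by metis
  obtain D where D: "\<And>x. (1 + norm x) ^ k * (\<Prod>w\<leftarrow>ws. \<bar>w x\<bar>) * \<bar>g x\<bar> \<le> D"
    using rapidE[OF g ws] by metis
  have "(1 + norm x) ^ k * (\<Prod>w\<leftarrow>ws. \<bar>w x\<bar>) * \<bar>f x + g x\<bar> \<le> C + D" for x
  proof -
    have "(1 + norm x) ^ k * (\<Prod>w\<leftarrow>ws. \<bar>w x\<bar>) * \<bar>f x + g x\<bar>
      \<le> (1 + norm x) ^ k * (\<Prod>w\<leftarrow>ws. \<bar>w x\<bar>) * (\<bar>f x\<bar> + \<bar>g x\<bar>)"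
      by (intro mult_left_mono mult_nonneg_nonneg prod_list_abs_nonneg) auto
    with C[of x] D[of x] show ?thesis by (simp add: distrib_left)
  qed
  then show "\<exists>C. \<forall>x. (1 + norm x) ^ k * (\<Prod>w\<leftarrow>ws. \<bar>w x\<bar>) * \<bar>f x + g x\<bar> \<le> C" by blast
qed

lemma rapid_cmult:
  assumes f: "rapid \<W> f"
  shows "rapid \<W> (\<lambda>x. c * f x)"
proof (rule rapidI)
  show "continuous_on UNIV (\<lambda>x. c * f x)"
    using assms by (intro continuous_on_mult continuous_on_const rapid_continuous)
  fix ws k assume ws: "set ws \<subseteq> \<W>"
  obtain C where C: "\<And>x. (1 + norm x) ^ k * (\<Prod>w\<leftarrow>ws. \<bar>w x\<bar>) * \<bar>f x\<bar> \<le> C"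
    using rapidE[OF f ws] by metis
  have "(1 + norm x) ^ k * (\<Prod>w\<leftarrow>ws. \<bar>w x\<bar>) * \<bar>c * f x\<bar> \<le> \<bar>c\<bar> * C" for x
    using mult_left_mono[OF C[of x], of "\<bar>c\<bar>"] by (simp add: abs_mult ac_simps)
  then show "\<exists>C. \<forall>x. (1 + norm x) ^ k * (\<Prod>w\<leftarrow>ws. \<bar>w x\<bar>) * \<bar>c * f x\<bar> \<le> C" by blast
qed

lemma rapid_sum:
  assumes "\<And>i. i \<in> A \<Longrightarrow> rapid \<W> (f i)"
  shows "rapid \<W> (\<lambda>x. \<Sum>i\<in>A. f i x)"
  using assms
proof (induction A rule: infinite_finite_induct)
  case (insert i A)
  then show ?case by (simp add: rapid_add)
qed (auto simp: rapid_def intro: exI[of _ 0])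

lemma rapid_bound:
  assumes "rapid \<W> f"
  obtains C where "C \<ge> 0" "\<And>x. \<bar>f x\<bar> \<le> C * (1 / (1 + norm x) ^ k)"
proof -
  obtain C where C: "\<And>x. (1 + norm x) ^ k * \<bar>f x\<bar> \<le> C"
    using rapidE[OF assms, of "[]" k] by auto
  have "0 \<le> C" using C[of 0] by (metis abs_ge_zero mult_1 norm_zero add_0_right power_one order_trans)
  moreover have "\<bar>f x\<bar> \<le> C * (1 / (1 + norm x) ^ k)" for x
  proof -
    have "(1 + norm x) ^ k > 0" by (simp add: add_pos_nonneg)
    then show ?thesis using C[of x] by (simp add: field_simps)
  qed
  ultimately show ?thesis using that by blast
qed

lemma rapid_integrable:
  fixes f :: "'x::euclidean_space \<Rightarrow> real"
  assumes "rapid \<W> f"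
  shows "integrable lborel f"
proof -
  obtain C where C: "C \<ge> 0" "\<And>x. \<bar>f x\<bar> \<le> C * (1 / (1 + norm x) ^ (2 * DIM('x)))"
    using rapid_bound[OF assms] by metis
  show ?thesis
  proof (rule Bochner_Integration.integrable_bound)
    show "integrable lborel (\<lambda>x::'x. C * (1 / (1 + norm x) ^ (2 * DIM('x))))"
      by (intro integrable_mult_right integrable_inverse_power_norm)
    show "f \<in> borel_measurable lborel"
      using rapid_continuous[OF assms] by (simp add: borel_measurable_continuous_onI)
    show "AE x in lborel. norm (f x) \<le> norm (C * (1 / (1 + norm x) ^ (2 * DIM('x))))"
      using C by (intro AE_I2) (auto intro: order_trans[OF _ abs_ge_self])
  qed
qed

text \<open>The integral of a difference quotient vanishes by translation invariance, and the difference
  quotients converge dominatedly to the partial derivative.\<close>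

lemma integral_pd_eq_0:
  fixes G :: "'x::euclidean_space \<Rightarrow> real"
  assumes sm: "smooth_on UNIV G" and G: "rapid \<W> G" and G': "rapid \<W> (pd b G)" and b: "b \<in> Basis"
  shows "(\<integral>x. pd b G x \<partial>lborel) = 0"
proof -
  define k where "k = 2 * DIM('x)"
  define q where "q = (\<lambda>n x. (G (x + (1 / real (Suc n)) *\<^sub>R b) - G x) / (1 / real (Suc n)))"
  obtain C where C: "C \<ge> 0" "\<And>x. \<bar>pd b G x\<bar> \<le> C * (1 / (1 + norm x) ^ k)"
    using rapid_bound[OF G'] by metis
  have shift: "integrable lborel (\<lambda>x. G (x + c)) \<and> (\<integral>x. G (x + c) \<partial>lborel) = (\<integral>x. G x \<partial>lborel)" for c
  proof -
    have m: "G \<in> borel_measurable borel"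
      using rapid_continuous[OF G] by (simp add: borel_measurable_continuous_onI)
    have "integrable (distr lborel borel ((+) c)) G"
      using rapid_integrable[OF G] by (simp add: lborel_distr_plus)
    then have "integrable lborel (\<lambda>x. G (c + x))"
      using m by (subst (asm) integrable_distr_eq) auto
    moreover have "(\<integral>x. G (c + x) \<partial>lborel) = (\<integral>x. G x \<partial>distr lborel borel ((+) c))"
      using m by (subst integral_distr) auto
    ultimately show ?thesis by (simp add: lborel_distr_plus add.commute)
  qed
  have int_q: "(\<integral>x. q n x \<partial>lborel) = 0" for n
    unfolding q_def using shift rapid_integrable[OF G] by simp
  have bound: "\<bar>q n x\<bar> \<le> C * 2 ^ k * (1 / (1 + norm x) ^ k)" for n x
  proof -
    define h where "h = 1 / real (Suc n)"
    have h: "0 < h" "h \<le> 1" by (auto simp: h_def)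
    obtain z where z: "0 < z" "z < h"
      "G (x + h *\<^sub>R b) - G (x + 0 *\<^sub>R b) = (h - 0) * pd b G (x + z *\<^sub>R b)"
      using MVT2[OF h(1), of "\<lambda>h. G (x + h *\<^sub>R b)" "\<lambda>h. pd b G (x + h *\<^sub>R b)"] smooth_on_has_pd[OF sm]
      by blast
    then have "q n x = pd b G (x + z *\<^sub>R b)"
      using h unfolding q_def h_def[symmetric] by simp
    \<comment> \<open>Since \<open>z\<close> is at most \<open>1\<close> and \<open>b\<close> is a
      unit vector, 1 + |x| is at most twice 1 + |x + z b|. This is the origin of
      \<open>2 ^ k\<close>, and it makes the dominating function independent of
      \<open>n\<close>.\<close>
    moreover have "1 / (1 + norm (x + z *\<^sub>R b)) ^ k \<le> 2 ^ k * (1 / (1 + norm x) ^ k)"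
    proof -
      have "norm x \<le> norm (x + z *\<^sub>R b) + norm (z *\<^sub>R b)"
        by (metis add_diff_cancel_right' norm_triangle_ineq4)
      then have "1 + norm x \<le> 2 * (1 + norm (x + z *\<^sub>R b))"
        using z h b norm_ge_zero[of "x + z *\<^sub>R b"] by (simp del: norm_ge_zero)
      then have "(1 + norm x) ^ k \<le> 2 ^ k * (1 + norm (x + z *\<^sub>R b)) ^ k"
        by (metis add_nonneg_nonneg norm_ge_zero power_mono power_mult_distrib zero_le_one)
      moreover have "(1 + norm x) ^ k > 0" "(1 + norm (x + z *\<^sub>R b)) ^ k > 0"
        by (simp_all add: add_pos_nonneg)
      ultimately show ?thesis by (simp add: field_simps)
    qed
    ultimately show ?thesis
      using C(2)[of "x + z *\<^sub>R b"] mult_left_mono[OF _ C(1)] by (metis mult.assoc order_trans)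
  qed
  have "(\<lambda>n. \<integral>x. q n x \<partial>lborel) \<longlonglongrightarrow> (\<integral>x. pd b G x \<partial>lborel)"
  proof (rule integral_dominated_convergence)
    show "integrable lborel (\<lambda>x::'x. C * 2 ^ k * (1 / (1 + norm x) ^ k))"
      unfolding k_def by (intro integrable_mult_right integrable_inverse_power_norm)
    show "AE x in lborel. norm (q n x) \<le> C * 2 ^ k * (1 / (1 + norm x) ^ k)" for n
      using bound by simp
    show "AE x in lborel. (\<lambda>n. q n x) \<longlonglongrightarrow> pd b G x"
    proof (rule AE_I2)
      fix x
      have "((\<lambda>h. (G (x + h *\<^sub>R b) - G x) / h) \<longlongrightarrow> pd b G x) (at 0)"
        using smooth_on_has_pd_0[OF sm, of x b] by (simp add: DERIV_def)
      moreover have "filterlim (\<lambda>n. 1 / real (Suc n)) (at 0) sequentially"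
        using LIMSEQ_inverse_real_of_nat by (auto simp: filterlim_at inverse_eq_divide)
      ultimately show "(\<lambda>n. q n x) \<longlonglongrightarrow> pd b G x"
        unfolding q_def by (rule filterlim_compose)
    qed
    show "pd b G \<in> borel_measurable lborel"
      using rapid_continuous[OF G'] by (simp add: borel_measurable_continuous_onI)
    show "q n \<in> borel_measurable lborel" for n
      unfolding q_def using rapid_continuous[OF G]
      by (simp, intro borel_measurable_continuous_onI continuous_intros continuous_on_compose2[OF rapid_continuous[OF G]]) auto
  qed
  then show ?thesis unfolding int_q by (simp add: LIMSEQ_const_iff)
qed

text \<open>The decay hypothesis speaks of space-time weights. Each weight on the slice is lifted to
  a member of the jet, entry by entry along the list, and the hypothesis is used with time horizon
  \<open>t\<close>.\<close>

lemma rapidly_decaying_slice: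
  assumes "rapidly_decaying ti W F" "g \<in> jet ti F" "ti \<le> t" "continuous_on UNIV (\<lambda>x. g x t)"
  shows "rapid {\<lambda>x. w x t |w. w \<in> jet ti W} (\<lambda>x. g x t)"
proof (rule rapidI)
  fix ws :: "('a \<Rightarrow> real) list" and k
  assume ws: "set ws \<subseteq> {\<lambda>x. w x t |w. w \<in> jet ti W}"
  have "\<exists>vs. set vs \<subseteq> jet ti W \<and> ws = map (\<lambda>v x. v x t) vs"
    using ws
  proof (induction ws)
    case (Cons w ws)
    then obtain vs v where "set vs \<subseteq> jet ti W" "ws = map (\<lambda>v x. v x t) vs" "v \<in> jet ti W" "w = (\<lambda>x. v x t)"
      by auto
    then show ?case by (intro exI[of _ "v # vs"]) auto
  qed simp
  then obtain vs where vs: "set vs \<subseteq> jet ti W" "ws = map (\<lambda>v x. v x t) vs" by blast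
  obtain C where C: "\<forall>s\<in>{ti..t}. \<forall>x. (1 + norm x) ^ k * (\<Prod>w\<leftarrow>vs. \<bar>w x s\<bar>) * \<bar>g x s\<bar> \<le> C"
    using assms(1,2) vs(1) unfolding rapidly_decaying_def by blast
  have "(1 + norm x) ^ k * (\<Prod>w\<leftarrow>ws. \<bar>w x\<bar>) * \<bar>g x t\<bar> \<le> C" for x
    using C assms(3) by (simp add: vs(2) o_def)
  then show "\<exists>C. \<forall>x. (1 + norm x) ^ k * (\<Prod>w\<leftarrow>ws. \<bar>w x\<bar>) * \<bar>g x t\<bar> \<le> C" by blast
qed (fact assms(4))

section \<open>Fundamental matrices of linear systems\<close>

text \<open>The choice in \<open>matrix_inverse_on\<close> is meaningful only once some two-sided
  inverse exists. An enumeration \<open>e\<close> of \<open>S\<close> turns \<open>A\<close> into a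
  square matrix \<open>A'\<close>; injectivity gives a nonzero determinant, hence a unit of the
  matrix ring, whose inverse is carried back along \<open>e\<close>.\<close>

lemma matrix_inverse_on:
  fixes A :: "'i \<Rightarrow> 'i \<Rightarrow> real"
  assumes S: "finite S"
    and inj: "\<And>v. (\<And>i. i \<in> S \<Longrightarrow> (\<Sum>j\<in>S. A i j * v j) = 0) \<Longrightarrow> (\<And>j. j \<in> S \<Longrightarrow> v j = 0)"
    and "i \<in> S" "j \<in> S"
  shows "(\<Sum>k\<in>S. matrix_inverse_on S A i k * A k j) = (if i = j then 1 else 0)"
proof -
  define n where "n = card S"
  obtain e where e: "bij_betw e {0..<n} S"
    using ex_bij_betw_nat_finite[OF S] unfolding n_def by blast
  define r where "r = the_inv_into {0..<n} e"
  have re: "r (e k) = k" if "k < n" for k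
    unfolding r_def using e that by (intro the_inv_into_f_f) (auto simp: bij_betw_def)
  have er: "e (r i) = i" "r i < n" if "i \<in> S" for i
  proof -
    show "e (r i) = i"
      unfolding r_def using e that by (intro f_the_inv_into_f) (auto simp: bij_betw_def)
    show "r i < n" using that e re by (auto simp: bij_betw_def)
  qed
  have sumS: "(\<Sum>k\<in>S. f k) = (\<Sum>k = 0..<n. f (e k))" for f :: "'i \<Rightarrow> real"
    using sum.reindex_bij_betw[OF e, of f] by simp
  define A' where "A' = mat n n (\<lambda>(i, j). A (e i) (e j))"
  have A': "A' \<in> carrier_mat n n" by (simp add: A'_def)
  have "det A' \<noteq> 0"
  proof
    assume "det A' = 0"
    then obtain v where v: "v \<in> carrier_vec n" "v \<noteq> 0\<^sub>v n" "A' *\<^sub>v v = 0\<^sub>v n"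
      using det_0_iff_vec_prod_zero[OF A'] by blast
    have "vec_index v (r j) = 0" if "j \<in> S" for j
    proof (rule inj[of "\<lambda>j. vec_index v (r j)", OF _ that])
      fix i assume i: "i \<in> S"
      have "0 = vec_index (A' *\<^sub>v v) (r i)" using er(2)[OF i] v(3) by simp
      also have "\<dots> = (\<Sum>k = 0..<n. A i (e k) * vec_index v k)"
        using v(1) er[OF i] by (auto simp: A'_def scalar_prod_def intro!: sum.cong)
      also have "\<dots> = (\<Sum>k\<in>S. A i k * vec_index v (r k))"
        unfolding sumS by (rule sum.cong) (auto simp: re)
      finally show "(\<Sum>k\<in>S. A i k * vec_index v (r k)) = 0" by simp
    qed
    then have "vec_index v k = 0" if "k < n" for k
      using re[OF that] e that by (metis bij_betwE atLeastLessThan_iff zero_le)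
    then have "v = 0\<^sub>v n" using v(1) by (intro eq_vecI) auto
    with v(2) show False by simp
  qed
  \<comment> \<open>The argument \<open>()\<close> only fills the extension slot of the ring
    record.\<close>
  then obtain B where B: "B \<in> carrier_mat n n" "B * A' = 1\<^sub>m n" "A' * B = 1\<^sub>m n"
    using det_non_zero_imp_unit[OF A', of "()"] by (auto simp: Units_def ring_mat_def)
  define B' where "B' = (\<lambda>i j. index_mat B (r i, r j))"
  have l: "(\<Sum>k\<in>S. A i k * B' k j) = (if i = j then 1 else 0)" if ij: "i \<in> S" "j \<in> S" for i j
  proof -
    have "index_mat (A' * B) (r i, r j) = (\<Sum>k = 0..<n. A i (e k) * index_mat B (k, r j))"
      using er[OF ij(1)] er[OF ij(2)] B(1) A' by (auto simp: scalar_prod_def A'_def intro!: sum.cong)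
    also have "\<dots> = (\<Sum>k\<in>S. A i k * B' k j)"
      unfolding sumS B'_def by (rule sum.cong) (auto simp: re)
    finally show ?thesis
      using B(3) er[OF ij(1)] er[OF ij(2)] by (auto simp: one_mat_def) metis
  qed
  have r: "(\<Sum>k\<in>S. B' i k * A k j) = (if i = j then 1 else 0)" if ij: "i \<in> S" "j \<in> S" for i j
  proof -
    have "index_mat (B * A') (r i, r j) = (\<Sum>k = 0..<n. index_mat B (r i, k) * A (e k) j)"
      using er[OF ij(1)] er[OF ij(2)] B(1) A' by (auto simp: scalar_prod_def A'_def intro!: sum.cong)
    also have "\<dots> = (\<Sum>k\<in>S. B' i k * A k j)"
      unfolding sumS B'_def by (rule sum.cong) (auto simp: re)
    finally show ?thesis
      using B(2) er[OF ij(1)] er[OF ij(2)] by (auto simp: one_mat_def) metis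
  qed
  have "\<forall>i\<in>S. \<forall>j\<in>S.
     (\<Sum>k\<in>S. A i k * matrix_inverse_on S A k j) = (if i = j then 1 else 0) \<and>
     (\<Sum>k\<in>S. matrix_inverse_on S A i k * A k j) = (if i = j then 1 else 0)"
    unfolding matrix_inverse_on_def by (rule someI[where x = B']) (use l r in blast)
  then show ?thesis using assms(3,4) by blast
qed

text \<open>Gronwall in backward form: the energy \<open>E\<close> satisfies |E'| <= c E, so exp (c
  t) E is nondecreasing; it is nonnegative and vanishes at \<open>T\<close>, hence also at
  \<open>ti\<close>.\<close>

lemma linear_ode_zero_backward:
  fixes y :: "'i \<Rightarrow> real \<Rightarrow> real" and D :: "real \<Rightarrow> 'i \<Rightarrow> 'i \<Rightarrow> real"
  assumes S: "finite S" and T: "ti \<le> T"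
    and ode: "\<And>i t. i \<in> S \<Longrightarrow> t \<in> {ti..T} \<Longrightarrow>
      (y i has_real_derivative - (\<Sum>k\<in>S. D t i k * y k t)) (at t within {ti..T})"
    and K: "\<And>i k t. i \<in> S \<Longrightarrow> k \<in> S \<Longrightarrow> t \<in> {ti..T} \<Longrightarrow> \<bar>D t i k\<bar> \<le> K"
    and yT: "\<And>i. i \<in> S \<Longrightarrow> y i T = 0"
    and i: "i \<in> S"
  shows "y i ti = 0"
proof -
  \<comment> \<open>Bounding 2 |y_i y_k| by y_i^2 + y_k^2 in the double sum counts every square
    \<open>2 * card S\<close> times.\<close>
  define c where "c = 2 * K * real (card S)"
  define E where "E = (\<lambda>t. \<Sum>i\<in>S. (y i t)\<^sup>2)"
  define E' where "E' = (\<lambda>t. \<Sum>i\<in>S. 2 * y i t * - (\<Sum>k\<in>S. D t i k * y k t))"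
  have dE: "(E has_real_derivative E' t) (at t within {ti..T})" if "t \<in> {ti..T}" for t
    unfolding E_def E'_def using that by (auto intro!: derivative_eq_intros ode sum.cong)
  have bound: "\<bar>E' t\<bar> \<le> c * E t" if t: "t \<in> {ti..T}" for t
  proof -
    have "E' t = - (\<Sum>i\<in>S. \<Sum>k\<in>S. 2 * D t i k * (y i t * y k t))"
      unfolding E'_def by (simp add: sum_distrib_left sum_negf ac_simps)
    then have "\<bar>E' t\<bar> \<le> (\<Sum>i\<in>S. \<Sum>k\<in>S. \<bar>2 * D t i k * (y i t * y k t)\<bar>)"
      by (simp only: abs_minus_cancel) (intro order_trans[OF sum_abs] sum_mono sum_abs)
    also have "\<dots> \<le> (\<Sum>i\<in>S. \<Sum>k\<in>S. K * ((y i t)\<^sup>2 + (y k t)\<^sup>2))"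
    proof (intro sum_mono)
      fix i k assume ik: "i \<in> S" "k \<in> S"
      have "2 * \<bar>y i t * y k t\<bar> \<le> (y i t)\<^sup>2 + (y k t)\<^sup>2"
        using sum_squares_bound[of "\<bar>y i t\<bar>" "\<bar>y k t\<bar>"] by (simp add: abs_mult)
      then have "\<bar>D t i k\<bar> * (2 * \<bar>y i t * y k t\<bar>) \<le> K * ((y i t)\<^sup>2 + (y k t)\<^sup>2)"
        using K[OF ik t] by (intro mult_mono) auto
      then show "\<bar>2 * D t i k * (y i t * y k t)\<bar> \<le> K * ((y i t)\<^sup>2 + (y k t)\<^sup>2)"
        by (simp add: abs_mult ac_simps)
    qed
    also have "\<dots> = c * E t"
      unfolding c_def E_def
      by (simp add: sum.distrib distrib_left sum_distrib_left[symmetric] algebra_simps)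
    finally show ?thesis .
  qed
  have "exp (c * ti) * E ti \<le> exp (c * T) * E T"
  proof (rule DERIV_nonneg_imp_increasing_open[OF T])
    show "continuous_on {ti..T} (\<lambda>t. exp (c * t) * E t)"
      by (intro continuous_intros DERIV_continuous_on[OF dE])
    fix t assume t: "ti < t" "t < T"
    then have "(E has_real_derivative E' t) (at t)"
      using dE[of t] by (simp add: at_within_Icc_at)
    then have "((\<lambda>t. exp (c * t) * E t) has_real_derivative exp (c * t) * (c * E t + E' t)) (at t)"
      by (auto intro!: derivative_eq_intros simp: algebra_simps)
    moreover have "0 \<le> exp (c * t) * (c * E t + E' t)"
      using bound[of t] t by (intro mult_nonneg_nonneg) auto
    ultimately show "\<exists>d. ((\<lambda>t. exp (c * t) * E t) has_real_derivative d) (at t) \<and> 0 \<le> d" by blast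
  qed
  moreover have "E T = 0" unfolding E_def using yT by simp
  ultimately have "E ti \<le> 0" by (simp add: mult_le_0_iff)
  moreover have "(y i ti)\<^sup>2 \<le> E ti" unfolding E_def using S i by (intro member_le_sum) auto
  ultimately show ?thesis by (metis order_trans power2_less_eq_zero_iff)
qed

section \<open>First-order perturbation theory\<close>

lemma rapid_diff: "rapid \<W> f \<Longrightarrow> rapid \<W> g \<Longrightarrow> rapid \<W> (\<lambda>x. f x - g x)"
  using rapid_add[OF _ rapid_cmult[of \<W> g "-1"]] by simp

lemma integral_divergence_eq_0:
  fixes X :: "'x::euclidean_space \<Rightarrow> 'x \<Rightarrow> real"
  assumes "\<And>b. b \<in> Basis \<Longrightarrow> smooth_on UNIV (X b)"
    and "\<And>b. b \<in> Basis \<Longrightarrow> rapid \<W> (X b)"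
    and "\<And>b. b \<in> Basis \<Longrightarrow> rapid \<W> (pd b (X b))"
  shows "(\<integral>x. (\<Sum>b\<in>Basis. pd b (X b) x) \<partial>lborel) = 0"
proof -
  have "integrable lborel (pd b (X b))" if "b \<in> Basis" for b
    using that by (rule rapid_integrable[OF assms(3)])
  moreover have "(\<integral>x. pd b (X b) x \<partial>lborel) = 0" if b: "b \<in> Basis" for b
    by (rule integral_pd_eq_0[OF assms(1)[OF b] assms(2)[OF b] assms(3)[OF b] b])
  ultimately show ?thesis by (subst Bochner_Integration.integral_sum) auto
qed

text \<open>Two spatial derivatives suffice for the divergences integrated below: their fluxes
  contain at most first derivatives of these functions.\<close>

definition rapid2 :: "('x::euclidean_space \<Rightarrow> real) set \<Rightarrow> ('x \<Rightarrow> real) \<Rightarrow> bool" where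
  "rapid2 \<W> f \<longleftrightarrow> smooth_on UNIV f \<and> rapid \<W> f \<and> (\<forall>b\<in>Basis. rapid \<W> (pd b f)) \<and>
     (\<forall>b\<in>Basis. \<forall>c\<in>Basis. rapid \<W> (pd b (pd c f)))"

text \<open>The counterpart of \<open>rapid2\<close> for the potential and its time derivative: no
  decay, but permission to multiply by the function and its derivatives.\<close>

definition weight2 :: "('x::euclidean_space \<Rightarrow> real) set \<Rightarrow> ('x \<Rightarrow> real) \<Rightarrow> bool" where
  "weight2 \<W> w \<longleftrightarrow> smooth_on UNIV w \<and> w \<in> \<W> \<and> (\<forall>b\<in>Basis. pd b w \<in> \<W>) \<and>
     (\<forall>b\<in>Basis. \<forall>c\<in>Basis. pd b (pd c w) \<in> \<W>)"

lemma rapid2D: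
  assumes "rapid2 \<W> f"
  shows "smooth_on UNIV f" "rapid \<W> f" "b \<in> Basis \<Longrightarrow> rapid \<W> (pd b f)"
    "b \<in> Basis \<Longrightarrow> c \<in> Basis \<Longrightarrow> rapid \<W> (pd b (pd c f))"
  using assms by (auto simp: rapid2_def)

lemma weight2D:
  assumes "weight2 \<W> w"
  shows "smooth_on UNIV w"
    "rapid \<W> f \<Longrightarrow> rapid \<W> (\<lambda>x. f x * w x)"
    "b \<in> Basis \<Longrightarrow> rapid \<W> f \<Longrightarrow> rapid \<W> (\<lambda>x. f x * pd b w x)"
    "b \<in> Basis \<Longrightarrow> c \<in> Basis \<Longrightarrow> rapid \<W> f \<Longrightarrow> rapid \<W> (\<lambda>x. f x * pd b (pd c w) x)"
proof -
  show sm: "smooth_on UNIV w" using assms by (simp add: weight2_def)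
  show "rapid \<W> f \<Longrightarrow> rapid \<W> (\<lambda>x. f x * w x)"
    using assms by (intro rapid_mult_weight smooth_on_imp_continuous_on) (auto simp: weight2_def)
  show "b \<in> Basis \<Longrightarrow> rapid \<W> f \<Longrightarrow> rapid \<W> (\<lambda>x. f x * pd b w x)"
    using assms by (intro rapid_mult_weight smooth_on_imp_continuous_on smooth_on_pd)
      (auto simp: weight2_def)
  show "b \<in> Basis \<Longrightarrow> c \<in> Basis \<Longrightarrow> rapid \<W> f \<Longrightarrow> rapid \<W> (\<lambda>x. f x * pd b (pd c w) x)"
    using assms by (intro rapid_mult_weight smooth_on_imp_continuous_on smooth_on_pd)
      (auto simp: weight2_def)
qed

text \<open>The set where \<open>h\<close> is nonzero is open by continuity and negligible by the
  vanishing integral, hence empty.\<close>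

lemma continuous_nonneg_integral_eq_0:
  fixes h :: "'x::euclidean_space \<Rightarrow> real"
  assumes h: "continuous_on UNIV h" "\<And>x. 0 \<le> h x" "integrable lborel h" "(\<integral>x. h x \<partial>lborel) = 0"
  shows "h x = 0"
proof (rule ccontr)
  assume "h x \<noteq> 0"
  have "AE x in lborel. h x = 0"
    using integral_nonneg_eq_0_iff_AE[OF h(3)] h(2,4) by simp
  moreover have "{x. h x \<noteq> 0} \<in> sets lborel"
    using h(1) by (simp, intro borel_open open_Collect_neq continuous_on_const) auto
  ultimately have "{x. h x \<noteq> 0} \<in> null_sets lborel"
    by (simp add: AE_iff_null_sets)
  then have "negligible {x. h x \<noteq> 0}"
    by (simp add: negligible_iff_null_sets null_sets_completionI)
  moreover have "open {x. h x \<noteq> 0}"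
    using h(1) by (intro open_Collect_neq continuous_on_const) auto
  ultimately show False using open_not_negligible \<open>h x \<noteq> 0\<close> by blast
qed

text \<open>With \<open>W1\<close> and \<open>v\<close> the time derivatives of the potential \<open>W\<close> and of the eigenfunction
  \<open>g\<close>, this is the off-diagonal coupling formula of perturbation theory, stripped of the factors
  \<open>exp (\<plusminus> \<beta> W / 2)\<close>.\<close>

lemma perturbation_identity:
  fixes f g v W W1 :: "'x::euclidean_space \<Rightarrow> real"
  assumes \<nu>: "\<nu> > 0" and \<beta>: "\<beta> > 0"
    and f: "rapid2 \<W> f" and g: "rapid2 \<W> g" and v: "rapid2 \<W> v"
    and W: "weight2 \<W> W" and W1: "weight2 \<W> W1"
    and Hf: "\<And>x. hamiltonian \<nu> \<beta> W f x = a * f x"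
    and Hg: "\<And>x. hamiltonian \<nu> \<beta> W g x = c * g x"
    and Hv: "\<And>x. hamiltonian \<nu> \<beta> W v x + (\<Sum>b\<in>Basis. - (1 / (2 * \<nu>)) * pd b (pd b W1) x
        + (\<beta> / (2 * \<nu>)) * (pd b W x * pd b W1 x)) * g x = c' * g x + c * v x"
    and orth: "(\<integral>x. f x * g x \<partial>lborel) = 0"
  shows "(a - c) * (\<integral>x. f x * (v x - \<beta> / 2 * (g x * W1 x)) \<partial>lborel) =
    (1 / \<nu>) * (\<integral>x. f x * (\<Sum>b\<in>Basis. pd b g x * pd b W1 x - \<beta> / 2 * (g x * pd b W x * pd b W1 x)
        + g x * pd b (pd b W1) x) \<partial>lborel)"
proof -
  \<comment> \<open>This is Green's flux (1 / (\<nu> \<beta>)) (f \<partial>w - w \<partial>f) for w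
    = v - (\<beta> / 2) g W1, written out; \<open>Y\<close> is its derivative, in which the products
    of first derivatives of f and w have cancelled.\<close>
  define X where "X = (\<lambda>b x. (1 / (\<nu> * \<beta>)) * (f x * pd b v x - v x * pd b f x)
     + (1 / (2 * \<nu>)) * ((g x * pd b f x - f x * pd b g x) * W1 x - f x * g x * pd b W1 x))"
  define Y where "Y = (\<lambda>b x. (1 / (\<nu> * \<beta>)) * (f x * pd b (pd b v) x - v x * pd b (pd b f) x)
     + (1 / (2 * \<nu>)) * ((g x * pd b (pd b f) x - f x * pd b (pd b g) x) * W1 x
        - 2 * (f x * pd b g x * pd b W1 x) - f x * g x * pd b (pd b W1) x))"
  note D = rapid2D[OF f] rapid2D[OF g] rapid2D[OF v]
  note sm = rapid2D(1)[OF f] rapid2D(1)[OF g] rapid2D(1)[OF v] weight2D(1)[OF W] weight2D(1)[OF W1]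
  have smX: "smooth_on UNIV (X b)" for b
  proof -
    have "smooth_on UNIV (\<lambda>x. (1 / (\<nu> * \<beta>)) * (f x * pd b v x + (- 1) * (v x * pd b f x))
     + (1 / (2 * \<nu>)) * ((g x * pd b f x + (- 1) * (f x * pd b g x)) * W1 x + (- 1) * (f x * g x * pd b W1 x)))"
      by (intro smooth_on_add smooth_on_mult smooth_on_const smooth_on_pd sm)
    then show ?thesis by (simp add: X_def)
  qed
  have pdX: "pd b (X b) x = Y b x" for b x
  proof (rule pd_eqI)
    show "((\<lambda>h. X b (x + h *\<^sub>R b)) has_real_derivative Y b x) (at 0)"
      unfolding X_def Y_def
      by (rule derivative_eq_intros smooth_on_has_pd_0 sm smooth_on_pd refl)+
        (simp add: algebra_simps)
  qed
  have rX: "rapid \<W> (X b)" if "b \<in> Basis" for b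
    unfolding X_def using that
    by (intro rapid_add rapid_cmult rapid_diff rapid_mult weight2D(2,3)[OF W1] D)
  have rY: "rapid \<W> (Y b)" if "b \<in> Basis" for b
    unfolding Y_def using that
    by (intro rapid_add rapid_cmult rapid_diff rapid_mult weight2D(2-)[OF W1] D)
  have "(\<integral>x. (\<Sum>b\<in>Basis. pd b (X b) x) \<partial>lborel) = 0"
    by (rule integral_divergence_eq_0[where \<W> = \<W>]) (use smX rX rY pdX in \<open>auto simp: pdX[abs_def]\<close>)
  then have int0: "(\<integral>x. (\<Sum>b\<in>Basis. Y b x) \<partial>lborel) = 0" by (simp add: pdX)
  define P where "P = (\<lambda>x. f x * (v x - \<beta> / 2 * (g x * W1 x)))"
  define Q where "Q = (\<lambda>b x. pd b g x * pd b W1 x - \<beta> / 2 * (g x * pd b W x * pd b W1 x)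
        + g x * pd b (pd b W1) x)"
  have point: "(\<Sum>b\<in>Basis. Y b x) = (a - c) * P x - (1 / \<nu>) * (f x * (\<Sum>b\<in>Basis. Q b x)) - c' * (f x * g x)" for x
  proof -
    \<comment> \<open>The right-hand side is arranged so that \<open>a * f x\<close>,
      \<open>c * g x\<close> and \<open>c' * g x + c * v x\<close> occur literally; the three
      eigenvalue equations, read backwards, then replace them by differential expressions.\<close>
    have "(a - c) * P x - c' * (f x * g x) =
      v x * (a * f x) - f x * (c' * g x + c * v x) - \<beta> / 2 * W1 x * (g x * (a * f x) - f x * (c * g x))"
      unfolding P_def by (simp add: field_simps)
    also have "\<dots> = (\<Sum>b\<in>Basis. Y b x) + (1 / \<nu>) * (f x * (\<Sum>b\<in>Basis. Q b x))"
      unfolding Hf[symmetric] Hg[symmetric] Hv[symmetric] hamiltonian_eq sum_distrib_left sum_distrib_right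
        sum.distrib[symmetric] sum_subtractf[symmetric] Y_def Q_def
      by (rule sum.cong) (use \<nu> \<beta> in \<open>simp_all add: field_simps power2_eq_square\<close>)
    finally show ?thesis by simp
  qed
  have rP: "rapid \<W> P"
    unfolding P_def by (intro rapid_diff rapid_cmult rapid_mult weight2D(2)[OF W1] D)
  have rQ: "rapid \<W> (\<lambda>x. f x * (\<Sum>b\<in>Basis. Q b x))"
    unfolding Q_def
    by (intro rapid_mult rapid_sum rapid_add rapid_diff rapid_cmult weight2D(3-)[OF W1] weight2D(3)[OF W] D)
  have rfg: "rapid \<W> (\<lambda>x. f x * g x)" by (intro rapid_mult D)
  \<comment> \<open>After integration the derivative \<open>c'\<close> of the eigenvalue survives
    only as a factor of the integral of f g, which \<open>orth\<close> removes.\<close>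
  have "0 = (a - c) * (\<integral>x. P x \<partial>lborel) - (1 / \<nu>) * (\<integral>x. f x * (\<Sum>b\<in>Basis. Q b x) \<partial>lborel)
      - c' * (\<integral>x. f x * g x \<partial>lborel)"
    unfolding int0[symmetric] point
    using rapid_integrable[OF rP] rapid_integrable[OF rQ] rapid_integrable[OF rfg] by simp
  then show ?thesis unfolding P_def Q_def orth by simp
qed

text \<open>Completing the square: \<nu> \<beta> f H f plus the divergence of \<open>X\<close>
  equals the sum of the squares of \<open>q\<close>. As H f = 0, these squares integrate to zero,
  and continuity makes them vanish at every point.\<close>

lemma ground_state_gradient:
  fixes f W :: "'x::euclidean_space \<Rightarrow> real"
  assumes \<nu>: "\<nu> > 0" and \<beta>: "\<beta> > 0" and f: "rapid2 \<W> f" and W: "weight2 \<W> W"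
    and Hf: "\<And>x. hamiltonian \<nu> \<beta> W f x = 0" and b: "b \<in> Basis"
  shows "pd b f x = - (\<beta> / 2) * (f x * pd b W x)"
proof -
  define q where "q = (\<lambda>b x. pd b f x + \<beta> / 2 * (f x * pd b W x))"
  define X where "X = (\<lambda>b x. f x * pd b f x + \<beta> / 2 * (f x * f x * pd b W x))"
  define Y where "Y = (\<lambda>b x. pd b f x * pd b f x + f x * pd b (pd b f) x
     + \<beta> / 2 * (2 * (pd b f x * f x * pd b W x) + f x * f x * pd b (pd b W) x))"
  note D = rapid2D[OF f]
  note sm = rapid2D(1)[OF f] weight2D(1)[OF W]
  have smX: "smooth_on UNIV (X b)" for b
    unfolding X_def by (intro smooth_on_add smooth_on_mult smooth_on_const smooth_on_pd sm)
  have pdX: "pd b (X b) x = Y b x" for b x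
  proof (rule pd_eqI)
    show "((\<lambda>h. X b (x + h *\<^sub>R b)) has_real_derivative Y b x) (at 0)"
      unfolding X_def Y_def
      by (rule derivative_eq_intros smooth_on_has_pd_0 sm smooth_on_pd refl)+
        (simp add: algebra_simps)
  qed
  have rX: "rapid \<W> (X b)" if "b \<in> Basis" for b
    unfolding X_def using that by (intro rapid_add rapid_cmult rapid_mult weight2D(3)[OF W] D)
  have rY: "rapid \<W> (Y b)" if "b \<in> Basis" for b
    unfolding Y_def using that
    by (intro rapid_add rapid_cmult rapid_mult weight2D(3-)[OF W] D)
  have "(\<integral>x. (\<Sum>b\<in>Basis. pd b (X b) x) \<partial>lborel) = 0"
    by (rule integral_divergence_eq_0[where \<W> = \<W>]) (use smX rX rY pdX in \<open>auto simp: pdX[abs_def]\<close>)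
  moreover have "(\<Sum>b\<in>Basis. pd b (X b) x) = (\<Sum>b\<in>Basis. (q b x)\<^sup>2)" for x
  proof -
    have "(\<Sum>b\<in>Basis. (q b x)\<^sup>2) = (\<Sum>b\<in>Basis. Y b x) + \<nu> * \<beta> * (f x * hamiltonian \<nu> \<beta> W f x)"
      unfolding hamiltonian_eq sum_distrib_left sum.distrib[symmetric] Y_def q_def
      by (rule sum.cong) (use \<nu> \<beta> in \<open>simp_all add: field_simps power2_eq_square\<close>)
    then show ?thesis by (simp add: Hf pdX)
  qed
  ultimately have int0: "(\<integral>x. (\<Sum>b\<in>Basis. (q b x)\<^sup>2) \<partial>lborel) = 0" by simp
  have rq: "rapid \<W> (\<lambda>x. \<Sum>b\<in>Basis. (q b x)\<^sup>2)"
    unfolding q_def power2_eq_square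
    by (intro rapid_sum rapid_mult rapid_add rapid_cmult weight2D(3)[OF W] D)
  have "(\<Sum>b\<in>Basis. (q b x)\<^sup>2) = 0"
    by (rule continuous_nonneg_integral_eq_0[where h = "\<lambda>x. \<Sum>b\<in>Basis. (q b x)\<^sup>2", OF rapid_continuous[OF rq] _ rapid_integrable[OF rq] int0])
      (simp add: sum_nonneg)
  then have "(q b x)\<^sup>2 = 0" using b by (subst (asm) sum_nonneg_eq_0_iff) auto
  then show ?thesis by (simp add: q_def)
qed

text \<open>By \<open>ground_state_gradient\<close> the function exp (\<beta> W / 2) f is constant
  in space, so testing the divergence-form operator against it gives the integral of a pure
  divergence. Without the exponentials, its flux is \<open>X\<close>.\<close>

lemma ground_state_coupling_eq_0:
  fixes f g W W1 :: "'x::euclidean_space \<Rightarrow> real"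
  assumes \<nu>: "\<nu> > 0" and \<beta>: "\<beta> > 0"
    and f: "rapid2 \<W> f" and g: "rapid2 \<W> g" and W: "weight2 \<W> W" and W1: "weight2 \<W> W1"
    and Hf: "\<And>x. hamiltonian \<nu> \<beta> W f x = 0"
  shows "(\<integral>x. f x * (\<Sum>b\<in>Basis. pd b g x * pd b W1 x - \<beta> / 2 * (g x * pd b W x * pd b W1 x)
        + g x * pd b (pd b W1) x) \<partial>lborel) = 0"
proof -
  define X where "X = (\<lambda>b x. f x * g x * pd b W1 x)"
  define Y where "Y = (\<lambda>b x. pd b f x * g x * pd b W1 x + f x * pd b g x * pd b W1 x
     + f x * g x * pd b (pd b W1) x)"
  note D = rapid2D[OF f] rapid2D[OF g]
  note sm = rapid2D(1)[OF f] rapid2D(1)[OF g] weight2D(1)[OF W1]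
  have smX: "smooth_on UNIV (X b)" for b
    unfolding X_def by (intro smooth_on_mult smooth_on_pd sm)
  have pdX: "pd b (X b) x = Y b x" for b x
    unfolding X_def Y_def using sm
    by (simp add: pd_mult smooth_on_mult smooth_on_pd algebra_simps)
  have rX: "rapid \<W> (X b)" if "b \<in> Basis" for b
    unfolding X_def using that by (intro rapid_mult weight2D(3)[OF W1] D)
  have rY: "rapid \<W> (Y b)" if "b \<in> Basis" for b
    unfolding Y_def using that by (intro rapid_add rapid_mult weight2D(3-)[OF W1] D)
  have "(\<integral>x. (\<Sum>b\<in>Basis. pd b (X b) x) \<partial>lborel) = 0"
    by (rule integral_divergence_eq_0[where \<W> = \<W>]) (use smX rX rY pdX in \<open>auto simp: pdX[abs_def]\<close>)
  moreover have "(\<Sum>b\<in>Basis. pd b (X b) x) = f x * (\<Sum>b\<in>Basis. pd b g x * pd b W1 x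
      - \<beta> / 2 * (g x * pd b W x * pd b W1 x) + g x * pd b (pd b W1) x)" for x
    unfolding sum_distrib_left pdX Y_def
    by (rule sum.cong) (simp_all add: ground_state_gradient[OF \<nu> \<beta> f W Hf] algebra_simps)
  ultimately show ?thesis by simp
qed

section \<open>The foot and head states\<close>

lemma jetI:
  assumes "G \<in> {F, \<lambda>x t. dt ti (F x) t}"
  shows "G \<in> jet ti F"
    and "b \<in> Basis \<Longrightarrow> (\<lambda>x t. pd b (\<lambda>y. G y t) x) \<in> jet ti F"
    and "b \<in> Basis \<Longrightarrow> c \<in> Basis \<Longrightarrow> (\<lambda>x t. pd b (pd c (\<lambda>y. G y t)) x) \<in> jet ti F"
  unfolding jet_def
  by (rule UN_I[OF assms], blast)+

text \<open>The jet holds two spatial derivatives of both \<open>F\<close> and its time derivative,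
  which is the supply needed to place both in \<open>rapid2\<close> on each time slice.\<close>

lemma rapid_of_jet:
  assumes "rapidly_decaying ti W F" "smooth_on (UNIV \<times> {ti..}) (case_prod F)" "ti \<le> t"
  shows "rapid2 {\<lambda>x. w x t |w. w \<in> jet ti W} (\<lambda>x. F x t)"
    and "rapid2 {\<lambda>x. w x t |w. w \<in> jet ti W} (\<lambda>x. dt ti (F x) t)"
proof -
  have *: "rapid2 {\<lambda>x. w x t |w. w \<in> jet ti W} (\<lambda>x. G x t)"
    if G: "G \<in> {F, \<lambda>x t. dt ti (F x) t}" and sm: "smooth_on UNIV (\<lambda>x. G x t)" for G
    unfolding rapid2_def
  proof (intro conjI ballI sm)
    show "rapid {\<lambda>x. w x t |w. w \<in> jet ti W} (\<lambda>x. G x t)"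
      by (intro rapidly_decaying_slice[OF assms(1) jetI(1)[OF G] assms(3)] smooth_on_imp_continuous_on sm)
    show "rapid {\<lambda>x. w x t |w. w \<in> jet ti W} (pd b (\<lambda>x. G x t))" if "b \<in> Basis" for b
      by (intro rapidly_decaying_slice[OF assms(1) jetI(2)[OF G that] assms(3)]
          smooth_on_imp_continuous_on smooth_on_pd sm)
    show "rapid {\<lambda>x. w x t |w. w \<in> jet ti W} (pd b (pd c (\<lambda>x. G x t)))"
      if "b \<in> Basis" "c \<in> Basis" for b c
      by (intro rapidly_decaying_slice[OF assms(1) jetI(3)[OF G that] assms(3)]
          smooth_on_imp_continuous_on smooth_on_pd sm)
  qed
  show "rapid2 {\<lambda>x. w x t |w. w \<in> jet ti W} (\<lambda>x. F x t)"
    using assms(2,3) by (intro *[of F] smooth_on_slice) auto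
  show "rapid2 {\<lambda>x. w x t |w. w \<in> jet ti W} (\<lambda>x. dt ti (F x) t)"
    using assms(2,3)
    by (intro *[of "\<lambda>x. dt ti (F x)"] smooth_on_slice[of ti "\<lambda>x. dt ti (F x)"] smooth_on_spacetime_dt) auto
qed

lemma weight_of_jet:
  assumes "smooth_on (UNIV \<times> {ti..}) (case_prod W)" "ti \<le> t"
  shows "weight2 {\<lambda>x. w x t |w. w \<in> jet ti W} (\<lambda>x. W x t)"
    and "weight2 {\<lambda>x. w x t |w. w \<in> jet ti W} (\<lambda>x. dt ti (W x) t)"
proof -
  have *: "weight2 {\<lambda>x. w x t |w. w \<in> jet ti W} (\<lambda>x. G x t)"
    if G: "G \<in> {W, \<lambda>x t. dt ti (W x) t}" and sm: "smooth_on UNIV (\<lambda>x. G x t)" for G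
    unfolding weight2_def
  proof (intro conjI ballI sm)
    show "(\<lambda>x. G x t) \<in> {\<lambda>x. w x t |w. w \<in> jet ti W}"
      using jetI(1)[OF G] by (intro CollectI exI[of _ G]) simp
    show "pd b (\<lambda>x. G x t) \<in> {\<lambda>x. w x t |w. w \<in> jet ti W}" if "b \<in> Basis" for b
      using jetI(2)[OF G that] by (intro CollectI exI[of _ "\<lambda>x t. pd b (\<lambda>y. G y t) x"]) simp
    show "pd b (pd c (\<lambda>x. G x t)) \<in> {\<lambda>x. w x t |w. w \<in> jet ti W}"
      if "b \<in> Basis" "c \<in> Basis" for b c
      using jetI(3)[OF G that] by (intro CollectI exI[of _ "\<lambda>x t. pd b (pd c (\<lambda>y. G y t)) x"]) simp
  qed
  show "weight2 {\<lambda>x. w x t |w. w \<in> jet ti W} (\<lambda>x. W x t)"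
    using assms by (intro *[of W] smooth_on_slice) auto
  show "weight2 {\<lambda>x. w x t |w. w \<in> jet ti W} (\<lambda>x. dt ti (W x) t)"
    using assms
    by (intro *[of "\<lambda>x. dt ti (W x)"] smooth_on_slice[of ti "\<lambda>x. dt ti (W x)"] smooth_on_spacetime_dt) auto
qed

section \<open>Time derivatives of the spectral data\<close>

lemma smooth_on_atLeast_dt:
  fixes f :: "real \<Rightarrow> real"
  assumes "smooth_on {ti..} f"
  shows "ti \<le> t \<Longrightarrow> (f has_real_derivative dt ti f t) (at t within {ti..})"
    and "continuous_on {ti..} (dt ti f)"
proof -
  \<comment> \<open>A dummy one-dimensional space variable turns \<open>f\<close> into a space-time
    function, so that the results on \<open>dt\<close> apply.\<close>
  have *: "smooth_on (UNIV \<times> {ti..}) (case_prod (\<lambda>(x::real) t. f t))"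
    using smooth_on_compose[OF smooth_on_bounded_linear[OF bounded_linear_snd] _ assms,
        of "(UNIV :: real set) \<times> {ti..}"]
    by (simp add: case_prod_unfold)
  show "ti \<le> t \<Longrightarrow> (f has_real_derivative dt ti f t) (at t within {ti..})"
    by (rule smooth_on_has_dt[OF *])
  have "continuous_on {ti..} (\<lambda>t. case (0::real, t) of (x, t) \<Rightarrow> dt ti f t)"
    by (rule continuous_on_compose2[OF smooth_on_imp_continuous_on[OF smooth_on_spacetime_dt[OF *]]])
      (auto intro!: continuous_intros)
  then show "continuous_on {ti..} (dt ti f)" by simp
qed

lemma dt_pd2_commute:
  assumes F: "smooth_on (UNIV \<times> {ti..}) (case_prod F)" and t: "ti \<le> t"
  shows "((\<lambda>s. pd b (pd c (\<lambda>y. F y s)) x) has_real_derivative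
    pd b (pd c (\<lambda>y. dt ti (F y) t)) x) (at t within {ti..})"
proof -
  have "(\<lambda>y. dt ti (\<lambda>s. pd c (\<lambda>z. F z s) y) t) = pd c (\<lambda>y. dt ti (F y) t)"
    using dt_eqI[OF dt_pd_commute[OF F t] t] by blast
  then show ?thesis
    using dt_pd_commute[OF smooth_on_spacetime_pd[OF F] t, of b c x] by simp
qed

text \<open>The added sum is the time derivative of the operator itself, acting on \<open>F\<close>;
  differentiating the squared gradient doubles \<beta> / (4 \<nu>) to \<beta> / (2 \<nu>).\<close>

lemma hamiltonian_has_dt:
  assumes F: "smooth_on (UNIV \<times> {ti..}) (case_prod F)" and W: "smooth_on (UNIV \<times> {ti..}) (case_prod W)"
    and t: "ti \<le> t"
  shows "((\<lambda>s. hamiltonian \<nu> \<beta> (\<lambda>y. W y s) (\<lambda>y. F y s) x) has_real_derivative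
    hamiltonian \<nu> \<beta> (\<lambda>y. W y t) (\<lambda>y. dt ti (F y) t) x +
    (\<Sum>b\<in>Basis. - (1 / (2 * \<nu>)) * pd b (pd b (\<lambda>y. dt ti (W y) t)) x
        + (\<beta> / (2 * \<nu>)) * (pd b (\<lambda>y. W y t) x * pd b (\<lambda>y. dt ti (W y) t) x)) * F x t) (at t within {ti..})"
  unfolding hamiltonian_eq sum_distrib_right sum.distrib[symmetric]
  by (rule DERIV_sum)
    (rule derivative_eq_intros dt_pd2_commute[OF F t] dt_pd2_commute[OF W t] dt_pd_commute[OF W t]
      smooth_on_has_dt[OF F t] refl | simp add: algebra_simps)+

text \<open>All data are already composed with the protocol, so that only their dependence on time
  remains; the potential enters as \<open>W x t = V x (a t)\<close>.\<close>

locale foot_head_system =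
  fixes \<nu> \<beta> ti :: real
    and W :: "'x::euclidean_space \<Rightarrow> real \<Rightarrow> real"
    and lam :: "nat \<Rightarrow> real \<Rightarrow> real"
    and I :: "nat \<Rightarrow> 'i set"
    and u :: "nat \<Rightarrow> 'i \<Rightarrow> 'x \<Rightarrow> real \<Rightarrow> real"
    and N :: "nat \<Rightarrow> 'i \<Rightarrow> real \<Rightarrow> real"
  assumes nu: "\<nu> > 0" and beta: "\<beta> > 0"
    and W_smooth: "smooth_on (UNIV \<times> {ti..}) (case_prod W)"
    and I_finite: "finite (I n)"
    and lam_smooth: "smooth_on {ti..} (lam n)"
    and eigen: "i \<in> I n \<Longrightarrow> t \<ge> ti \<Longrightarrow>
      hamiltonian \<nu> \<beta> (\<lambda>y. W y t) (\<lambda>y. u n i y t) x = lam n t * u n i x t"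
    and orthonormal: "i \<in> I n \<Longrightarrow> j \<in> I m \<Longrightarrow> t \<ge> ti \<Longrightarrow>
      (\<integral>x. u n i x t * u m j x t \<partial>lborel) = (if n = m \<and> i = j then 1 else 0)"
    and u_smooth: "i \<in> I n \<Longrightarrow> smooth_on (UNIV \<times> {ti..}) (case_prod (u n i))"
    and u_decay: "i \<in> I n \<Longrightarrow> rapidly_decaying ti W (u n i)"
    and N_pos: "i \<in> I n \<Longrightarrow> t \<ge> ti \<Longrightarrow> N n i t > 0"
    and N_smooth: "i \<in> I n \<Longrightarrow> smooth_on {ti..} (N n i)"
begin

definition foot :: "nat \<Rightarrow> 'i \<Rightarrow> 'x \<Rightarrow> real \<Rightarrow> real" where
  "foot n i x t = sqrt (N n i t) * exp (- \<beta> * W x t / 2) * u n i x t"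

definition head :: "nat \<Rightarrow> 'i \<Rightarrow> 'x \<Rightarrow> real \<Rightarrow> real" where
  "head n i x t = 1 / sqrt (N n i t) * exp (\<beta> * W x t / 2) * u n i x t"

definition coupling :: "nat \<Rightarrow> nat \<Rightarrow> real \<Rightarrow> 'i \<Rightarrow> 'i \<Rightarrow> real" where
  "coupling n m t i k = (\<integral>x. head n i x t * dt ti (foot m k x) t \<partial>lborel)"

definition Ldot :: "nat \<Rightarrow> nat \<Rightarrow> real \<Rightarrow> 'i \<Rightarrow> 'i \<Rightarrow> real" where
  "Ldot n m t i k = (\<integral>x. head n i x t *
     fokker_planck_dt \<nu> (\<lambda>y. dt ti (W y) t) (\<lambda>y. foot m k y t) x \<partial>lborel)"

definition weights :: "real \<Rightarrow> ('x \<Rightarrow> real) set" where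
  "weights t = {\<lambda>x. w x t |w. w \<in> jet ti W}"

lemma u_rapid:
  assumes "i \<in> I n" "ti \<le> t"
  shows "rapid2 (weights t) (\<lambda>x. u n i x t)" "rapid2 (weights t) (\<lambda>x. dt ti (u n i x) t)"
  unfolding weights_def using assms by (auto intro: rapid_of_jet u_decay u_smooth)

lemma W_weight:
  assumes "ti \<le> t"
  shows "weight2 (weights t) (\<lambda>x. W x t)" "weight2 (weights t) (\<lambda>x. dt ti (W x) t)"
  unfolding weights_def using assms by (auto intro: weight_of_jet W_smooth)

lemma head_foot:
  assumes "i \<in> I n" "k \<in> I m" "ti \<le> t"
  shows "head n i x t * foot m k x t = sqrt (N m k t) / sqrt (N n i t) * (u n i x t * u m k x t)"
proof -
  have e: "exp (\<beta> * W x t / 2) * exp (- \<beta> * W x t / 2) = 1" by (simp flip: exp_add)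
  have "head n i x t * foot m k x t =
      sqrt (N m k t) / sqrt (N n i t) * (u n i x t * u m k x t) * (exp (\<beta> * W x t / 2) * exp (- \<beta> * W x t / 2))"
    by (simp add: head_def foot_def)
  then show ?thesis unfolding e by simp
qed

lemma head_foot_integral:
  assumes "i \<in> I n" "k \<in> I m" "ti \<le> t"
  shows "integrable lborel (\<lambda>x. head n i x t * foot m k x t)"
    and "(\<integral>x. head n i x t * foot m k x t \<partial>lborel) = (if n = m \<and> i = k then 1 else 0)"
proof -
  have "integrable lborel (\<lambda>x. u n i x t * u m k x t)"
    using assms by (intro rapid_integrable[where \<W> = "weights t"] rapid_mult rapid2D(2)[OF u_rapid(1)])
  then show "integrable lborel (\<lambda>x. head n i x t * foot m k x t)"
    unfolding head_foot[OF assms] by simp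
  show "(\<integral>x. head n i x t * foot m k x t \<partial>lborel) = (if n = m \<and> i = k then 1 else 0)"
    unfolding head_foot[OF assms] using orthonormal[OF assms] N_pos[OF assms(1,3)] by auto
qed

text \<open>The square root is differentiated logarithmically, which leaves the full prefactor of
  the foot state in front. Its exponential then cancels against that of a head state.\<close>

lemma foot_has_dt:
  assumes "k \<in> I m" "ti \<le> t"
  shows "(foot m k x has_real_derivative sqrt (N m k t) * exp (- \<beta> * W x t / 2) *
    (dt ti (N m k) t / (2 * N m k t) * u m k x t + (dt ti (u m k x) t - \<beta> / 2 * (u m k x t * dt ti (W x) t))))
    (at t within {ti..})"
proof -
  have pos: "N m k t > 0" using N_pos assms by blast
  have "((\<lambda>t. sqrt (N m k t)) has_real_derivative inverse (sqrt (N m k t)) / 2 * dt ti (N m k) t) (at t within {ti..})"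
    by (rule DERIV_chain2[OF DERIV_real_sqrt[OF pos] smooth_on_atLeast_dt(1)[OF N_smooth[OF assms(1)] assms(2)]])
  moreover have "inverse (sqrt (N m k t)) / 2 * dt ti (N m k) t = sqrt (N m k t) * (dt ti (N m k) t / (2 * N m k t))"
    using pos real_sqrt_pow2[of "N m k t"] by (simp add: field_simps power2_eq_square)
  ultimately have 1: "((\<lambda>t. sqrt (N m k t)) has_real_derivative
      sqrt (N m k t) * (dt ti (N m k) t / (2 * N m k t))) (at t within {ti..})" by (simp only:)
  show ?thesis
    unfolding foot_def
    by (rule derivative_eq_intros 1 smooth_on_has_dt[OF W_smooth assms(2)] smooth_on_has_dt[OF u_smooth[OF assms(1)] assms(2)] refl
       | simp)+ (simp add: algebra_simps)
qed

lemma head_dt_foot: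
  assumes "i \<in> I n" "k \<in> I m" "ti \<le> t"
  shows "head n i x t * dt ti (foot m k x) t = sqrt (N m k t) / sqrt (N n i t) *
    (dt ti (N m k) t / (2 * N m k t) * (u n i x t * u m k x t)
      + u n i x t * (dt ti (u m k x) t - \<beta> / 2 * (u m k x t * dt ti (W x) t)))"
proof -
  have e: "exp (\<beta> * W x t / 2) * exp (- \<beta> * W x t / 2) = 1" by (simp flip: exp_add)
  define D where "D = dt ti (N m k) t / (2 * N m k t) * u m k x t
    + (dt ti (u m k x) t - \<beta> / 2 * (u m k x t * dt ti (W x) t))"
  have "dt ti (foot m k x) t = sqrt (N m k t) * exp (- \<beta> * W x t / 2) * D"
    unfolding D_def by (rule dt_eqI[OF foot_has_dt[OF assms(2,3)] assms(3)])
  then have "head n i x t * dt ti (foot m k x) t =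
     sqrt (N m k t) / sqrt (N n i t) * (u n i x t * D) * (exp (\<beta> * W x t / 2) * exp (- \<beta> * W x t / 2))"
    by (simp add: head_def)
  then show ?thesis unfolding e D_def by (simp add: algebra_simps)
qed

lemma head_dt_foot_integrable:
  assumes "i \<in> I n" "k \<in> I m" "ti \<le> t"
  shows "integrable lborel (\<lambda>x. u n i x t * (dt ti (u m k x) t - \<beta> / 2 * (u m k x t * dt ti (W x) t)))"
    and "integrable lborel (\<lambda>x. head n i x t * dt ti (foot m k x) t)"
proof -
  note r = rapid2D(2)[OF u_rapid(1)[OF assms(1,3)]] rapid2D(2)[OF u_rapid(1)[OF assms(2,3)]]
    rapid2D(2)[OF u_rapid(2)[OF assms(2,3)]]
  show 1: "integrable lborel (\<lambda>x. u n i x t * (dt ti (u m k x) t - \<beta> / 2 * (u m k x t * dt ti (W x) t)))"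
    by (intro rapid_integrable[where \<W> = "weights t"] rapid_mult rapid_diff rapid_cmult r
        weight2D(2)[OF W_weight(2)[OF assms(3)]])
  have "integrable lborel (\<lambda>x. u n i x t * u m k x t)"
    by (intro rapid_integrable[where \<W> = "weights t"] rapid_mult r)
  with 1 show "integrable lborel (\<lambda>x. head n i x t * dt ti (foot m k x) t)"
    unfolding head_dt_foot[OF assms] by simp
qed

lemma head_fokker_planck_dt_foot:
  assumes "i \<in> I n" "k \<in> I m" "ti \<le> t"
  shows "head n i x t * fokker_planck_dt \<nu> (\<lambda>y. dt ti (W y) t) (\<lambda>y. foot m k y t) x =
    sqrt (N m k t) / sqrt (N n i t) * (1 / \<nu>) * (u n i x t *
      (\<Sum>b\<in>Basis. pd b (\<lambda>y. u m k y t) x * pd b (\<lambda>y. dt ti (W y) t) x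
        - \<beta> / 2 * (u m k x t * pd b (\<lambda>y. W y t) x * pd b (\<lambda>y. dt ti (W y) t) x)
        + u m k x t * pd b (pd b (\<lambda>y. dt ti (W y) t)) x))"
proof -
  have e: "exp (\<beta> * W x t / 2) * exp (- \<beta> * W x t / 2) = 1" by (simp flip: exp_add)
  have sW: "smooth_on UNIV (\<lambda>y. W y t)" by (rule smooth_on_slice[OF W_smooth assms(3)])
  have sW1: "smooth_on UNIV (\<lambda>y. dt ti (W y) t)" by (rule weight2D(1)[OF W_weight(2)[OF assms(3)]])
  have su: "smooth_on UNIV (\<lambda>y. u m k y t)" by (rule smooth_on_slice[OF u_smooth[OF assms(2)] assms(3)])
  have sg: "smooth_on UNIV (\<lambda>y. exp (- \<beta> * W y t / 2) * u m k y t)" by (rule smooth_on_gauge[OF su sW])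
  have f: "(\<lambda>y. foot m k y t) = (\<lambda>y. sqrt (N m k t) * (exp (- \<beta> * W y t / 2) * u m k y t))"
    by (simp add: foot_def mult.assoc)
  have "smooth_on UNIV (\<lambda>y. foot m k y t)"
    unfolding f by (intro smooth_on_mult smooth_on_const sg)
  note fp = fokker_planck_dt_eq[OF this sW1]
  have pdf: "pd b (\<lambda>y. foot m k y t) x = sqrt (N m k t) * exp (- \<beta> * W x t / 2) *
      (pd b (\<lambda>y. u m k y t) x + - \<beta> / 2 * (pd b (\<lambda>y. W y t) x * u m k x t))" for b
    unfolding f pd_cmult[OF sg] pd_gauge[OF su sW] by simp
  have "fokker_planck_dt \<nu> (\<lambda>y. dt ti (W y) t) (\<lambda>y. foot m k y t) x =
     sqrt (N m k t) * exp (- \<beta> * W x t / 2) * ((1 / \<nu>) * (\<Sum>b\<in>Basis. pd b (\<lambda>y. u m k y t) x * pd b (\<lambda>y. dt ti (W y) t) x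
        - \<beta> / 2 * (u m k x t * pd b (\<lambda>y. W y t) x * pd b (\<lambda>y. dt ti (W y) t) x)
        + u m k x t * pd b (pd b (\<lambda>y. dt ti (W y) t)) x))" (is "_ = _ * _ * ?D")
    unfolding fp unfolding pdf unfolding foot_def sum_distrib_left by (rule sum.cong) (simp_all add: algebra_simps)
  then have "head n i x t * fokker_planck_dt \<nu> (\<lambda>y. dt ti (W y) t) (\<lambda>y. foot m k y t) x =
     sqrt (N m k t) / sqrt (N n i t) * (u n i x t * ?D) * (exp (\<beta> * W x t / 2) * exp (- \<beta> * W x t / 2))"
    by (simp add: head_def)
  then show ?thesis unfolding e by simp
qed

text \<open>Both sides of the eigenvalue equation agree for all times from \<open>ti\<close> on, so
  their one-sided derivatives agree: \<open>hamiltonian_has_dt\<close> computes one and the product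
  rule the other.\<close>

lemma differentiated_eigen:
  assumes "i \<in> I n" "ti \<le> t"
  shows "hamiltonian \<nu> \<beta> (\<lambda>y. W y t) (\<lambda>y. dt ti (u n i y) t) x +
    (\<Sum>b\<in>Basis. - (1 / (2 * \<nu>)) * pd b (pd b (\<lambda>y. dt ti (W y) t)) x
        + (\<beta> / (2 * \<nu>)) * (pd b (\<lambda>y. W y t) x * pd b (\<lambda>y. dt ti (W y) t) x)) * u n i x t =
    dt ti (lam n) t * u n i x t + lam n t * dt ti (u n i x) t"
proof -
  have "((\<lambda>s. lam n s * u n i x s) has_real_derivative
      dt ti (lam n) t * u n i x t + lam n t * dt ti (u n i x) t) (at t within {ti..})"
    by (rule derivative_eq_intros smooth_on_atLeast_dt(1)[OF lam_smooth assms(2)]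
        smooth_on_has_dt[OF u_smooth[OF assms(1)] assms(2)] refl | simp)+
  then have "((\<lambda>s. hamiltonian \<nu> \<beta> (\<lambda>y. W y s) (\<lambda>y. u n i y s) x) has_real_derivative
      dt ti (lam n) t * u n i x t + lam n t * dt ti (u n i x) t) (at t within {ti..})"
    by (rule has_field_derivative_transform_within[of _ _ _ _ 1]) (use assms eigen in auto)
  from dt_eqI[OF this assms(2)]
    dt_eqI[OF hamiltonian_has_dt[OF u_smooth[OF assms(1)] W_smooth assms(2)] assms(2)]
  show ?thesis by simp
qed

text \<open>The derivative of the normalisation contributes a multiple of the integral of u_n u_m,
  zero for \<open>n \<noteq> m\<close>. What remains on both sides carries the same factor
  \<open>?r\<close>, so \<open>perturbation_identity\<close> transfers.\<close>

lemma coupling_eq: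
  assumes "i \<in> I n" "k \<in> I m" "ti \<le> t" "n \<noteq> m"
  shows "(lam n t - lam m t) * coupling n m t i k = Ldot n m t i k"
proof -
  let ?r = "sqrt (N m k t) / sqrt (N n i t)"
  have alg: "p = r * j \<Longrightarrow> a * j = q \<Longrightarrow> a * p = r * q" for p r j a q :: real
    by (metis mult.left_commute)
  have "integrable lborel (\<lambda>x. u n i x t * u m k x t)"
    using assms by (intro rapid_integrable[where \<W> = "weights t"] rapid_mult rapid2D(2)[OF u_rapid(1)])
  then have "coupling n m t i k = ?r *
      (\<integral>x. u n i x t * (dt ti (u m k x) t - \<beta> / 2 * (u m k x t * dt ti (W x) t)) \<partial>lborel)"
    unfolding coupling_def head_dt_foot[OF assms(1-3)]
    using head_dt_foot_integrable(1)[OF assms(1-3)] orthonormal[OF assms(1-3)] assms(4) by simp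
  moreover have "(lam n t - lam m t) *
      (\<integral>x. u n i x t * (dt ti (u m k x) t - \<beta> / 2 * (u m k x t * dt ti (W x) t)) \<partial>lborel) =
    (1 / \<nu>) * (\<integral>x. u n i x t * (\<Sum>b\<in>Basis. pd b (\<lambda>y. u m k y t) x * pd b (\<lambda>y. dt ti (W y) t) x
        - \<beta> / 2 * (u m k x t * pd b (\<lambda>y. W y t) x * pd b (\<lambda>y. dt ti (W y) t) x)
        + u m k x t * pd b (pd b (\<lambda>y. dt ti (W y) t)) x) \<partial>lborel)" (is "_ = _ * ?Q")
    by (rule perturbation_identity[OF nu beta u_rapid(1)[OF assms(1,3)] u_rapid(1)[OF assms(2,3)]
        u_rapid(2)[OF assms(2,3)] W_weight[OF assms(3)] eigen[OF assms(1,3)] eigen[OF assms(2,3)]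
        differentiated_eigen[OF assms(2,3)]])
      (use orthonormal[OF assms(1-3)] assms(4) in simp)
  ultimately have "(lam n t - lam m t) * coupling n m t i k = ?r * ((1 / \<nu>) * ?Q)"
    by (rule alg)
  then show ?thesis
    unfolding Ldot_def head_fokker_planck_dt_foot[OF assms(1-3)] by simp
qed

lemma Ldot_ground_state:
  assumes "i \<in> I n" "k \<in> I m" "ti \<le> t" "lam n t = 0"
  shows "Ldot n m t i k = 0"
  unfolding Ldot_def head_fokker_planck_dt_foot[OF assms(1-3)]
  using ground_state_coupling_eq_0[OF nu beta u_rapid(1)[OF assms(1,3)] u_rapid(1)[OF assms(2,3)]
      W_weight[OF assms(3)]] eigen[OF assms(1,3)] assms(4) by simp

text \<open>The local uniformity in time of \<open>rapidly_decaying\<close> enters here: one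
  integrable function dominates the integrand for all \<open>t\<close> up to \<open>T\<close>.
  Boundedness is what the Gronwall argument asks of the coefficients.\<close>

lemma coupling_bounded:
  assumes i: "i \<in> I n" and k: "k \<in> I m"
  shows "\<exists>K. \<forall>t\<in>{ti..T}. \<bar>coupling n m t i k\<bar> \<le> K"
proof -
  define p where "p = 2 * DIM('x)"
  have dec: "\<exists>C. \<forall>t\<in>{ti..T}. \<forall>x. (1 + norm x) ^ q * (\<Prod>w\<leftarrow>ws. \<bar>w x t\<bar>) * \<bar>g x t\<bar> \<le> C"
    if "j \<in> I l" "g \<in> jet ti (u l j)" "set ws \<subseteq> jet ti W" for j l g ws q
    using u_decay[OF that(1)] that(2,3) unfolding rapidly_decaying_def by blast
  have j: "u l j \<in> jet ti (u l j)" "(\<lambda>x. dt ti (u l j x)) \<in> jet ti (u l j)"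
      "(\<lambda>x. dt ti (W x)) \<in> jet ti W" for l j
    by (auto simp: jet_def)
  obtain C1 where "\<forall>t\<in>{ti..T}. \<forall>x. \<bar>u n i x t\<bar> \<le> C1"
    using dec[OF i j(1), of "[]" 0] by auto
  then have C1: "\<bar>u n i x t\<bar> \<le> C1" if "t \<in> {ti..T}" for t x
    using that by blast
  obtain C2 where "\<forall>t\<in>{ti..T}. \<forall>x. (1 + norm x) ^ p * \<bar>u m k x t\<bar> \<le> C2"
    using dec[OF k j(1), of "[]" p] by auto
  then have C2: "(1 + norm x) ^ p * \<bar>u m k x t\<bar> \<le> C2" if "t \<in> {ti..T}" for t x
    using that by blast
  obtain C3 where "\<forall>t\<in>{ti..T}. \<forall>x. (1 + norm x) ^ p * \<bar>dt ti (u m k x) t\<bar> \<le> C3"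
    using dec[OF k j(2), of "[]" p] by auto
  then have C3: "(1 + norm x) ^ p * \<bar>dt ti (u m k x) t\<bar> \<le> C3" if "t \<in> {ti..T}" for t x
    using that by blast
  obtain C4 where "\<forall>t\<in>{ti..T}. \<forall>x. (1 + norm x) ^ p * (\<bar>dt ti (W x) t\<bar> * \<bar>u m k x t\<bar>) \<le> C4"
    using dec[OF k j(1), of "[\<lambda>x. dt ti (W x)]" p] j(3) by (auto simp: mult.assoc)
  then have C4: "(1 + norm x) ^ p * (\<bar>dt ti (W x) t\<bar> * \<bar>u m k x t\<bar>) \<le> C4" if "t \<in> {ti..T}" for t x
    using that by blast
  have bdd: "\<exists>B. \<forall>t\<in>{ti..T}. \<bar>f t\<bar> \<le> B" if "continuous_on {ti..T} f" for f :: "real \<Rightarrow> real"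
    using compact_imp_bounded[OF compact_continuous_image[OF that compact_Icc]]
    by (auto simp: bounded_iff)
  have cN: "continuous_on {ti..T} (N l j)" "continuous_on {ti..T} (dt ti (N l j))" if "j \<in> I l" for l j
    using smooth_on_imp_continuous_on[OF N_smooth[OF that]] smooth_on_atLeast_dt(2)[OF N_smooth[OF that]]
    by (auto intro: continuous_on_subset)
  have N0: "N l j t \<noteq> 0" if "j \<in> I l" "t \<in> {ti..T}" for l j t
    using N_pos[OF that(1), of t] that(2) by auto
  have "continuous_on {ti..T} (\<lambda>t. sqrt (N m k t) / sqrt (N n i t))"
    using N0[OF i] by (intro continuous_intros cN i k) auto
  then obtain B1 where B1: "\<And>t. t \<in> {ti..T} \<Longrightarrow> \<bar>sqrt (N m k t) / sqrt (N n i t)\<bar> \<le> B1"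
    using bdd by blast
  have "continuous_on {ti..T} (\<lambda>t. dt ti (N m k) t / (2 * N m k t))"
    using N0[OF k] by (intro continuous_intros cN i k) auto
  then obtain B2 where B2: "\<And>t. t \<in> {ti..T} \<Longrightarrow> \<bar>dt ti (N m k) t / (2 * N m k t)\<bar> \<le> B2"
    using bdd by blast
  \<comment> \<open>The product and sum of bounds follow \<open>head_dt_foot\<close>:
    \<open>B1\<close> and \<open>B2\<close> bound the normalisation factors on the compact interval,
    \<open>C1\<close> bounds u_n, and \<open>C2\<close>, \<open>C3\<close>, \<open>C4\<close> bound
    the terms with u_m after multiplication by the power \<open>p\<close>.\<close>
  define K where "K = B1 * (C1 * (B2 * C2 + (C3 + \<beta> / 2 * C4)))"
  have bound: "\<bar>head n i x t * dt ti (foot m k x) t\<bar> \<le> K * (1 / (1 + norm x) ^ p)"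
    if t: "t \<in> {ti..T}" for t x
  proof -
    define d where "d = dt ti (N m k) t / (2 * N m k t)"
    define r where "r = sqrt (N m k t) / sqrt (N n i t)"
    define y where "y = (1 + norm x) ^ p"
    have y: "y > 0" unfolding y_def by (simp add: add_pos_nonneg)
    have B2': "\<bar>d\<bar> \<le> B2" "0 \<le> B2" and B1': "\<bar>r\<bar> \<le> B1" "0 \<le> B1" and C1': "0 \<le> C1"
      using B2[OF t] B1[OF t] C1[OF t, of x] unfolding d_def r_def by linarith+
    have c2: "\<bar>d\<bar> * (y * \<bar>u m k x t\<bar>) \<le> B2 * C2"
      unfolding y_def by (intro mult_mono C2[OF t] B2') auto
    have c4: "\<beta> / 2 * (y * (\<bar>dt ti (W x) t\<bar> * \<bar>u m k x t\<bar>)) \<le> \<beta> / 2 * C4"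
      unfolding y_def using beta by (intro mult_left_mono C4[OF t]) auto
    have "y * \<bar>d * u m k x t + (dt ti (u m k x) t - \<beta> / 2 * (u m k x t * dt ti (W x) t))\<bar>
      \<le> y * (\<bar>d\<bar> * \<bar>u m k x t\<bar> + (\<bar>dt ti (u m k x) t\<bar> + \<beta> / 2 * (\<bar>dt ti (W x) t\<bar> * \<bar>u m k x t\<bar>)))"
    proof (rule mult_left_mono)
      have "\<bar>\<beta> / 2 * (u m k x t * dt ti (W x) t)\<bar> = \<beta> / 2 * (\<bar>dt ti (W x) t\<bar> * \<bar>u m k x t\<bar>)"
        using beta by (simp add: abs_mult)
      then show "\<bar>d * u m k x t + (dt ti (u m k x) t - \<beta> / 2 * (u m k x t * dt ti (W x) t))\<bar>
        \<le> \<bar>d\<bar> * \<bar>u m k x t\<bar> + (\<bar>dt ti (u m k x) t\<bar> + \<beta> / 2 * (\<bar>dt ti (W x) t\<bar> * \<bar>u m k x t\<bar>))"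
        unfolding abs_mult[of d, symmetric] by linarith
    qed (use y in simp)
    also have "\<dots> = \<bar>d\<bar> * (y * \<bar>u m k x t\<bar>) + (y * \<bar>dt ti (u m k x) t\<bar>
        + \<beta> / 2 * (y * (\<bar>dt ti (W x) t\<bar> * \<bar>u m k x t\<bar>)))"
      by (simp add: algebra_simps)
    also have "\<dots> \<le> B2 * C2 + (C3 + \<beta> / 2 * C4)"
      using c2 c4 C3[OF t, of x] unfolding y_def by linarith
    finally have E: "y * \<bar>d * u m k x t + (dt ti (u m k x) t - \<beta> / 2 * (u m k x t * dt ti (W x) t))\<bar>
      \<le> B2 * C2 + (C3 + \<beta> / 2 * C4)" .
    have "head n i x t * dt ti (foot m k x) t =
       r * (u n i x t * (d * u m k x t + (dt ti (u m k x) t - \<beta> / 2 * (u m k x t * dt ti (W x) t))))"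
      using head_dt_foot[OF i k, of t x] t unfolding d_def r_def by (simp add: algebra_simps)
    then have "y * \<bar>head n i x t * dt ti (foot m k x) t\<bar> = \<bar>r\<bar> * (\<bar>u n i x t\<bar> *
       (y * \<bar>d * u m k x t + (dt ti (u m k x) t - \<beta> / 2 * (u m k x t * dt ti (W x) t))\<bar>))"
      by (simp only: abs_mult) (simp only: ac_simps)
    also have "\<dots> \<le> K"
      unfolding K_def using y by (intro mult_mono E C1[OF t] B1' C1') auto
    finally show ?thesis using y unfolding y_def[symmetric] by (simp add: field_simps)
  qed
  have "\<bar>coupling n m t i k\<bar> \<le> (\<integral>x. K * (1 / (1 + norm (x::'x)) ^ p) \<partial>lborel)" if t: "t \<in> {ti..T}" for t
  proof -
    have "\<bar>coupling n m t i k\<bar> \<le> (\<integral>x. \<bar>head n i x t * dt ti (foot m k x) t\<bar> \<partial>lborel)"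
      unfolding coupling_def by (rule integral_abs_bound)
    also have "\<dots> \<le> (\<integral>x. K * (1 / (1 + norm (x::'x)) ^ p) \<partial>lborel)"
      using t head_dt_foot_integrable(2)[OF i k, of t] integrable_inverse_power_norm bound[OF t]
      unfolding p_def
      by (intro integral_mono integrable_abs integrable_mult_right) auto
    finally show ?thesis .
  qed
  then show ?thesis by blast
qed

text \<open>The gauge factor is common to the whole eigenspace, so the sum is that factor times a
  function \<open>h\<close> with H h = lam h, and a single use of \<open>fokker_planck_gauge\<close>
  suffices.\<close>

lemma fokker_planck_foot_sum:
  assumes "ti \<le> t"
  shows "fokker_planck \<nu> \<beta> (\<lambda>y. W y t) (\<lambda>y. \<Sum>i\<in>I n. c i * foot n i y t) x =
    - (lam n t * (\<Sum>i\<in>I n. c i * foot n i x t))"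
proof -
  define h where "h = (\<lambda>y. \<Sum>i\<in>I n. c i * sqrt (N n i t) * u n i y t)"
  have sW: "smooth_on UNIV (\<lambda>y. W y t)" by (rule smooth_on_slice[OF W_smooth assms])
  have su: "smooth_on UNIV (\<lambda>y. u n i y t)" if "i \<in> I n" for i
    by (rule smooth_on_slice[OF u_smooth[OF that] assms])
  have sh: "smooth_on UNIV h"
    unfolding h_def by (intro smooth_on_sum smooth_on_mult smooth_on_const su)
  have eq: "(\<Sum>i\<in>I n. c i * foot n i y t) = exp (- \<beta> * W y t / 2) * h y" for y
    unfolding h_def foot_def sum_distrib_left by (rule sum.cong) auto
  have "hamiltonian \<nu> \<beta> (\<lambda>y. W y t) h x = lam n t * h x"
  proof -
    have "hamiltonian \<nu> \<beta> (\<lambda>y. W y t) h x =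
        (\<Sum>i\<in>I n. (c i * sqrt (N n i t)) * hamiltonian \<nu> \<beta> (\<lambda>y. W y t) (\<lambda>y. u n i y t) x)"
      unfolding h_def by (rule hamiltonian_sum[OF su])
    also have "\<dots> = (\<Sum>i\<in>I n. lam n t * (c i * sqrt (N n i t) * u n i x t))"
      using eigen[OF _ assms] by (intro sum.cong) auto
    finally show ?thesis by (simp add: h_def sum_distrib_left)
  qed
  then show ?thesis
    unfolding eq fokker_planck_gauge[OF sh sW nu beta] by simp
qed

end

section \<open>The coefficients of the expansion\<close>

context foot_head_system
begin

lemma head_foot_sum:
  assumes j: "j \<in> I n" and t: "ti \<le> t"
  shows "(\<integral>x. head n j x t * (\<Sum>k\<in>I m. c k * foot m k x t) \<partial>lborel) = (if m = n then c j else 0)"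
proof -
  have "(\<integral>x. head n j x t * (\<Sum>k\<in>I m. c k * foot m k x t) \<partial>lborel)
      = (\<integral>x. (\<Sum>k\<in>I m. c k * (head n j x t * foot m k x t)) \<partial>lborel)"
    by (simp add: sum_distrib_left mult.left_commute)
  also have "\<dots> = (\<Sum>k\<in>I m. c k * (if n = m \<and> j = k then 1 else 0))"
    using head_foot_integral[OF j _ t]
    by (subst Bochner_Integration.integral_sum) auto
  also have "\<dots> = (if m = n then c j else 0)"
    using I_finite[of m] j by (auto simp: if_distrib cong: if_cong)
  finally show ?thesis .
qed

text \<open>When the derivative falls on the coefficients, bi-orthogonality keeps one of them; when
  it falls on the foot states, the coupling numbers appear.\<close>

lemma head_dt_foot_sum:
  assumes j: "j \<in> I n" and t: "ti \<le> t"
    and c: "\<And>k. k \<in> I m \<Longrightarrow> (c k has_real_derivative c' k) (at t within {ti..})"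
  shows "(\<integral>x. head n j x t * dt ti (\<lambda>s. \<Sum>k\<in>I m. c k s * foot m k x s) t \<partial>lborel) =
    (if m = n then c' j else 0) + (\<Sum>k\<in>I m. c k t * coupling n m t j k)"
proof -
  have dt: "dt ti (\<lambda>s. \<Sum>k\<in>I m. c k s * foot m k x s) t =
      (\<Sum>k\<in>I m. c' k * foot m k x t + c k t * dt ti (foot m k x) t)" for x
  proof (rule dt_eqI[OF DERIV_sum t])
    fix k assume k: "k \<in> I m"
    have "(foot m k x has_real_derivative dt ti (foot m k x) t) (at t within {ti..})"
      using foot_has_dt[OF k t, of x] dt_eqI[OF foot_has_dt[OF k t, of x] t] by simp
    from DERIV_mult[OF c[OF k] this]
    show "((\<lambda>s. c k s * foot m k x s) has_real_derivative
        c' k * foot m k x t + c k t * dt ti (foot m k x) t) (at t within {ti..})"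
      by (simp add: algebra_simps)
  qed
  have i1: "integrable lborel (\<lambda>x. head n j x t * (\<Sum>k\<in>I m. c' k * foot m k x t))"
  proof -
    have "integrable lborel (\<lambda>x. \<Sum>k\<in>I m. c' k * (head n j x t * foot m k x t))"
      using head_foot_integral(1)[OF j _ t] by auto
    then show ?thesis by (simp add: sum_distrib_left mult.left_commute)
  qed
  have i2: "integrable lborel (\<lambda>x. head n j x t * (\<Sum>k\<in>I m. c k t * dt ti (foot m k x) t))"
    and e2: "(\<integral>x. head n j x t * (\<Sum>k\<in>I m. c k t * dt ti (foot m k x) t) \<partial>lborel) =
      (\<Sum>k\<in>I m. c k t * coupling n m t j k)"
  proof -
    have eq: "head n j x t * (\<Sum>k\<in>I m. c k t * dt ti (foot m k x) t) =
       (\<Sum>k\<in>I m. c k t * (head n j x t * dt ti (foot m k x) t))" for x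
      by (simp add: sum_distrib_left mult.left_commute)
    show "integrable lborel (\<lambda>x. head n j x t * (\<Sum>k\<in>I m. c k t * dt ti (foot m k x) t))"
      unfolding eq using head_dt_foot_integrable(2)[OF j _ t] by auto
    show "(\<integral>x. head n j x t * (\<Sum>k\<in>I m. c k t * dt ti (foot m k x) t) \<partial>lborel) =
      (\<Sum>k\<in>I m. c k t * coupling n m t j k)"
      unfolding eq coupling_def using head_dt_foot_integrable(2)[OF j _ t]
      by (subst Bochner_Integration.integral_sum) auto
  qed
  show ?thesis
    unfolding dt sum.distrib distrib_left
    using i1 i2 e2 head_foot_sum[OF j t, where m = m and c = c'] by simp
qed

lemma lam_integrable: "lam n integrable_on {ti..t}"
  by (rule integrable_continuous_real)
    (rule continuous_on_subset[OF smooth_on_imp_continuous_on[OF lam_smooth]], auto)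

lemma decay_factor_has_dt:
  assumes "ti \<le> t"
  shows "((\<lambda>t. exp (- integral {ti..t} (lam n))) has_real_derivative
    - lam n t * exp (- integral {ti..t} (lam n))) (at t within {ti..})"
proof -
  have "continuous_on {ti..t + 1} (lam n)"
    by (rule continuous_on_subset[OF smooth_on_imp_continuous_on[OF lam_smooth]]) auto
  then have "((\<lambda>t. integral {ti..t} (lam n)) has_real_derivative lam n t) (at t within {ti..t + 1})"
    using assms by (intro integral_has_real_derivative) auto
  from has_real_derivative_Icc_imp_Ici[OF this] show ?thesis
    by (auto intro!: derivative_eq_intros)
qed

text \<open>For a constant vector \<open>v\<close> the product \<open>y\<close> = M v solves the
  same system as the columns of \<open>M\<close>. If it vanishes at \<open>T\<close> it vanishes at
  \<open>ti\<close>, where it equals \<open>v\<close>.\<close>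

lemma evolution_matrix_injective:
  assumes M_ode: "\<And>i j t. i \<in> I n \<Longrightarrow> j \<in> I n \<Longrightarrow> t \<ge> ti \<Longrightarrow>
      ((\<lambda>s. M s i j) has_real_derivative - (\<Sum>k\<in>I n. coupling n n t i k * M t k j)) (at t within {ti..})"
    and M_init: "\<And>i j. i \<in> I n \<Longrightarrow> j \<in> I n \<Longrightarrow> M ti i j = (if i = j then 1 else 0)"
    and T: "ti \<le> T" and v: "\<And>i. i \<in> I n \<Longrightarrow> (\<Sum>j\<in>I n. M T i j * v j) = 0"
    and i: "i \<in> I n"
  shows "v i = 0"
proof -
  have "\<forall>i k. \<exists>K. i \<in> I n \<longrightarrow> k \<in> I n \<longrightarrow> (\<forall>t\<in>{ti..T}. \<bar>coupling n n t i k\<bar> \<le> K)"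
    using coupling_bounded by blast
  then obtain K where K: "\<And>i k t. i \<in> I n \<Longrightarrow> k \<in> I n \<Longrightarrow> t \<in> {ti..T} \<Longrightarrow> \<bar>coupling n n t i k\<bar> \<le> K i k"
    by metis
  define y where "y = (\<lambda>i t. \<Sum>j\<in>I n. M t i j * v j)"
  have "y i ti = 0"
  proof (rule linear_ode_zero_backward[where y = y and D = "coupling n n" and S = "I n" and T = T
        and K = "\<Sum>i\<in>I n. \<Sum>k\<in>I n. \<bar>K i k\<bar>"])
    fix i t assume it: "i \<in> I n" "t \<in> {ti..T}"
    have "(y i has_real_derivative (\<Sum>j\<in>I n. - (\<Sum>k\<in>I n. coupling n n t i k * M t k j) * v j)) (at t within {ti..})"
      unfolding y_def using it by (intro DERIV_sum DERIV_cmult_right M_ode) auto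
    also have "(\<Sum>j\<in>I n. - (\<Sum>k\<in>I n. coupling n n t i k * M t k j) * v j) = - (\<Sum>k\<in>I n. coupling n n t i k * y k t)"
      unfolding y_def by (simp add: sum_distrib_left sum_distrib_right sum_negf mult.assoc) (rule sum.swap)
    finally show "(y i has_real_derivative - (\<Sum>k\<in>I n. coupling n n t i k * y k t)) (at t within {ti..T})"
      by (rule DERIV_subset) auto
  next
    fix i k t assume ik: "i \<in> I n" "k \<in> I n" "t \<in> {ti..T}"
    have "\<bar>coupling n n t i k\<bar> \<le> \<bar>K i k\<bar>" using K[OF ik] by linarith
    also have "\<dots> \<le> (\<Sum>k\<in>I n. \<bar>K i k\<bar>)"
      using ik I_finite[of n] by (intro member_le_sum) auto
    also have "\<dots> \<le> (\<Sum>i\<in>I n. \<Sum>k\<in>I n. \<bar>K i k\<bar>)"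
      using ik I_finite[of n] by (intro member_le_sum[where f = "\<lambda>i. \<Sum>k\<in>I n. \<bar>K i k\<bar>"]) (auto intro: sum_nonneg)
    finally show "\<bar>coupling n n t i k\<bar> \<le> (\<Sum>i\<in>I n. \<Sum>k\<in>I n. \<bar>K i k\<bar>)" .
  qed (use T i v I_finite[of n] in \<open>auto simp: y_def\<close>)
  moreover have "y i ti = v i"
    unfolding y_def using M_init[OF i] i I_finite[of n] by (simp add: if_distrib[of "\<lambda>x. x * _"] cong: if_cong)
  ultimately show ?thesis by simp
qed

text \<open>The two termwise integrals of \<open>\<partial>\<^sub>t \<rho> = L \<rho>\<close> against a head state are compared; the
  equation for \<open>M\<close> is the one that cancels the diagonal term \<open>m = n\<close>.\<close>

lemma projected_equation:
  fixes M :: "nat \<Rightarrow> real \<Rightarrow> 'i \<Rightarrow> 'i \<Rightarrow> real" and C A :: "nat \<Rightarrow> 'i \<Rightarrow> real \<Rightarrow> real"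
  assumes M_ode: "\<And>n i j. i \<in> I n \<Longrightarrow> j \<in> I n \<Longrightarrow>
      ((\<lambda>s. M n s i j) has_real_derivative - (\<Sum>k\<in>I n. coupling n n t i k * M n t k j)) (at t within {ti..})"
    and C: "\<And>n i. i \<in> I n \<Longrightarrow> (C n i has_real_derivative C' n i) (at t within {ti..})"
    and A: "\<And>n i s. A n i s = (\<Sum>j\<in>I n. M n s i j * C n j s)"
    and R: "\<And>n x s. R n x s = (\<Sum>i\<in>I n. A n i s * exp (- integral {ti..s} (lam n)) * foot n i x s)"
    and equation: "\<And>x. dt ti (\<rho> x) t = fokker_planck \<nu> \<beta> (\<lambda>y. W y t) (\<lambda>y. \<rho> y t) x"
    and int_dt: "integrates_termwise (\<lambda>x. head n j x t) (\<lambda>m x. dt ti (R m x) t) (\<lambda>x. dt ti (\<rho> x) t)"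
    and int_fp: "integrates_termwise (\<lambda>x. head n j x t)
        (\<lambda>m. fokker_planck \<nu> \<beta> (\<lambda>y. W y t) (\<lambda>y. R m y t))
        (fokker_planck \<nu> \<beta> (\<lambda>y. W y t) (\<lambda>y. \<rho> y t))"
    and j: "j \<in> I n" and t: "ti \<le> t"
  shows "(\<lambda>m. if m = n then 0 else
      exp (- integral {ti..t} (lam m)) * (\<Sum>k\<in>I m. A m k t * coupling n m t j k))
    sums (- exp (- integral {ti..t} (lam n)) * (\<Sum>l\<in>I n. M n t j l * C' n l))"
proof -
  define e where "e = (\<lambda>m s. exp (- integral {ti..s} (lam m)))"
  define A' where "A' = (\<lambda>m i. - (\<Sum>k\<in>I m. coupling m m t i k * A m k t) + (\<Sum>l\<in>I m. M m t i l * C' m l))"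
  have dA: "(A m i has_real_derivative A' m i) (at t within {ti..})" if i: "i \<in> I m" for m i
  proof -
    have "(A m i has_real_derivative (\<Sum>l\<in>I m. - (\<Sum>k\<in>I m. coupling m m t i k * M m t k l) * C m l t
        + C' m l * M m t i l)) (at t within {ti..})"
      unfolding A[abs_def] using i by (intro DERIV_sum DERIV_mult M_ode C)
    also have "(\<Sum>l\<in>I m. - (\<Sum>k\<in>I m. coupling m m t i k * M m t k l) * C m l t + C' m l * M m t i l) = A' m i"
    proof -
      have "(\<Sum>l\<in>I m. (\<Sum>k\<in>I m. coupling m m t i k * M m t k l) * C m l t) =
          (\<Sum>k\<in>I m. coupling m m t i k * A m k t)"
        unfolding A sum_distrib_left sum_distrib_right mult.assoc by (rule sum.swap)
      then show ?thesis
        unfolding A'_def by (simp add: sum.distrib sum_subtractf sum_negf mult.commute[of "C' m _"])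
    qed
    finally show ?thesis .
  qed
  define h where "h = (\<lambda>m. \<Sum>k\<in>I m. (A m k t * e m t) * coupling n m t j k)"
  define c' where "c' = A' n j * e n t + - lam n t * e n t * A n j t"
  have "(\<integral>x. head n j x t * dt ti (R m x) t \<partial>lborel) = (if m = n then c' else 0) + h m" for m
  proof -
    have "((\<lambda>s. A m k s * e m s) has_real_derivative A' m k * e m t + - lam m t * e m t * A m k t) (at t within {ti..})"
      if "k \<in> I m" for k
      unfolding e_def by (intro DERIV_mult dA that decay_factor_has_dt t)
    from head_dt_foot_sum[OF j t this] show ?thesis
      unfolding R[abs_def] h_def c'_def e_def by auto
  qed
  then have s1: "(\<lambda>m. (if m = n then c' else 0) + h m) sums (\<integral>x. head n j x t * dt ti (\<rho> x) t \<partial>lborel)"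
    using int_dt by (simp add: integrates_termwise_def)
  have "(\<integral>x. head n j x t * fokker_planck \<nu> \<beta> (\<lambda>y. W y t) (\<lambda>y. R m y t) x \<partial>lborel) =
      (if m = n then - lam n t * (A n j t * e n t) else 0)" for m
  proof -
    have "head n j x t * fokker_planck \<nu> \<beta> (\<lambda>y. W y t) (\<lambda>y. R m y t) x =
        - lam m t * (head n j x t * (\<Sum>k\<in>I m. (A m k t * e m t) * foot m k x t))" for x
      unfolding R fokker_planck_foot_sum[OF t] e_def by simp
    then show ?thesis using head_foot_sum[OF j t, where m = m] by simp
  qed
  \<comment> \<open>The Fokker-Planck operator acts on each eigenvalue's contribution as a scalar,
    so projection leaves the term \<open>m = n\<close> alone and fixes the value of the
    integral.\<close>
  then have s2: "(\<lambda>m. if m = n then - lam n t * (A n j t * e n t) else 0) sums (\<integral>x. head n j x t * dt ti (\<rho> x) t \<partial>lborel)"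
    using int_fp by (simp add: integrates_termwise_def equation)
  have single: "(\<lambda>m. if m = n then z else 0) sums z" for z :: real
    using sums_single[of n "\<lambda>_. z"] by simp
  have "(\<integral>x. head n j x t * dt ti (\<rho> x) t \<partial>lborel) = - lam n t * (A n j t * e n t)"
    using sums_unique2[OF s2 single] .
  \<comment> \<open>Both diagonal contributions, from the coefficients and from the coupling within
    the block, are subtracted as one-term series, leaving the sum over
    \<open>m \<noteq> n\<close>.\<close>
  with sums_diff[OF sums_diff[OF s1 single[of c']] single[of "h n"]]
  have "(\<lambda>m. (if m = n then c' else 0) + h m - (if m = n then c' else 0) - (if m = n then h n else 0))
      sums (- lam n t * (A n j t * e n t) - c' - h n)" by simp
  moreover have "(\<lambda>m. (if m = n then c' else 0) + h m - (if m = n then c' else 0) - (if m = n then h n else 0))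
      = (\<lambda>m. if m = n then 0 else h m)" by auto
  \<comment> \<open>Two cancellations: the eigenvalue term of the equation against the derivative of
    the exponential inside \<open>c'\<close>, and the block coupling \<open>h n\<close> against the
    part of \<open>A'\<close> produced by the equation for \<open>M\<close>.\<close>
  moreover have "- lam n t * (A n j t * e n t) - c' - h n = - e n t * (\<Sum>l\<in>I n. M n t j l * C' n l)"
    unfolding c'_def h_def A'_def by (simp add: algebra_simps sum_distrib_left sum_negf)
  ultimately have "(\<lambda>m. if m = n then 0 else h m) sums (- e n t * (\<Sum>l\<in>I n. M n t j l * C' n l))"
    by (simp only:)
  moreover have "h m = e m t * (\<Sum>k\<in>I m. A m k t * coupling n m t j k)" for m
    unfolding h_def by (simp add: sum_distrib_left ac_simps)
  ultimately show ?thesis by (simp only: e_def)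
qed

text \<open>Row \<open>j\<close> of \<open>projected_equation\<close> is multiplied by
  \<open>B i j / e n\<close> and the rows are added. The left inverse property of \<open>B\<close>
  isolates \<open>C' n i\<close>; since the sum over \<open>j\<close> is finite, no infinite sums
  are interchanged.\<close>

lemma coefficient_equation:
  fixes M :: "nat \<Rightarrow> real \<Rightarrow> 'i \<Rightarrow> 'i \<Rightarrow> real" and C A :: "nat \<Rightarrow> 'i \<Rightarrow> real \<Rightarrow> real"
  assumes M_ode: "\<And>n i j t. i \<in> I n \<Longrightarrow> j \<in> I n \<Longrightarrow> t \<ge> ti \<Longrightarrow>
      ((\<lambda>s. M n s i j) has_real_derivative - (\<Sum>k\<in>I n. coupling n n t i k * M n t k j)) (at t within {ti..})"
    and M_init: "\<And>n i j. i \<in> I n \<Longrightarrow> j \<in> I n \<Longrightarrow> M n ti i j = (if i = j then 1 else 0)"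
    and lam_distinct: "\<And>n m. n \<noteq> m \<Longrightarrow> lam n t \<noteq> lam m t"
    and C: "\<And>n i. i \<in> I n \<Longrightarrow> (C n i has_real_derivative C' n i) (at t within {ti..})"
    and A: "\<And>n i t. A n i t = (\<Sum>j\<in>I n. M n t i j * C n j t)"
    and R: "\<And>n x s. R n x s = (\<Sum>i\<in>I n. A n i s * exp (- integral {ti..s} (lam n)) * foot n i x s)"
    and equation: "\<And>x. dt ti (\<rho> x) t = fokker_planck \<nu> \<beta> (\<lambda>y. W y t) (\<lambda>y. \<rho> y t) x"
    and int_dt: "\<And>i. i \<in> I n \<Longrightarrow>
      integrates_termwise (\<lambda>x. head n i x t) (\<lambda>m x. dt ti (R m x) t) (\<lambda>x. dt ti (\<rho> x) t)"
    and int_fp: "\<And>i. i \<in> I n \<Longrightarrow> integrates_termwise (\<lambda>x. head n i x t)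
        (\<lambda>m. fokker_planck \<nu> \<beta> (\<lambda>y. W y t) (\<lambda>y. R m y t))
        (fokker_planck \<nu> \<beta> (\<lambda>y. W y t) (\<lambda>y. \<rho> y t))"
    and i: "i \<in> I n" and t: "ti \<le> t"
    and S: "\<And>j m. S j m = (if m = n then 0 else (\<Sum>k\<in>I m. \<Sum>l\<in>I m.
        exp (integral {ti..t} (\<lambda>s. lam n s - lam m s)) *
        (matrix_inverse_on (I n) (M n t) i j * Ldot n m t j k * M m t k l
           / (lam n t - lam m t)) * C m l t))"
  shows "\<forall>j\<in>I n. summable (S j)" and "C' n i + (\<Sum>j\<in>I n. \<Sum>m. S j m) = 0"
    and "lam n t = 0 \<Longrightarrow> C' n i = 0"
proof -
  define B where "B = matrix_inverse_on (I n) (M n t)"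
  define e where "e = (\<lambda>m. exp (- integral {ti..t} (lam m)))"
  \<comment> \<open>As a function of \<open>m\<close>, \<open>S j\<close> is a constant multiple of
    the series already known to converge; this gives summability and value at once. The eigenvalue
    gap in the denominator turns \<open>Ldot\<close> back into \<open>coupling\<close>.\<close>
  have S_eq: "S j m = (B i j / e n) * (if m = n then 0 else e m * (\<Sum>k\<in>I m. A m k t * coupling n m t j k))"
    if j: "j \<in> I n" for j m
  proof (cases "m = n")
    case False
    have "exp (integral {ti..t} (\<lambda>s. lam n s - lam m s)) = e m / e n"
      unfolding e_def by (simp add: integral_diff lam_integrable exp_diff exp_minus field_simps)
    moreover have c: "coupling n m t j k = Ldot n m t j k / (lam n t - lam m t)" if "k \<in> I m" for k
      using coupling_eq[OF j that t] False lam_distinct[of n m] by (simp add: field_simps)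
    ultimately have "S j m = (\<Sum>k\<in>I m. \<Sum>l\<in>I m.
        (e m / e n) * (B i j * coupling n m t j k * M m t k l) * C m l t)"
      unfolding S B_def if_not_P[OF False]
      by (intro sum.cong refl) (simp add: c)
    also have "\<dots> = (B i j / e n) * (e m * (\<Sum>k\<in>I m. A m k t * coupling n m t j k))"
      unfolding A sum_distrib_left sum_distrib_right by (intro sum.cong refl) simp
    finally show ?thesis using False by simp
  qed (simp add: S)
  have sums: "S j sums - (B i j * (\<Sum>l\<in>I n. M n t j l * C' n l))" if j: "j \<in> I n" for j
  proof -
    have "(\<lambda>m. if m = n then 0 else e m * (\<Sum>k\<in>I m. A m k t * coupling n m t j k))
        sums (- e n * (\<Sum>l\<in>I n. M n t j l * C' n l))"
      unfolding e_def
      by (rule projected_equation[OF M_ode C A R equation int_dt[OF j] int_fp[OF j] j t]) (use t in auto)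
    from sums_mult[OF this, of "B i j / e n"] show ?thesis
      unfolding S_eq[OF j, abs_def] by (simp add: e_def)
  qed
  then show "\<forall>j\<in>I n. summable (S j)" by (auto intro: sums_summable)
  have inv: "(\<Sum>j\<in>I n. B i j * M n t j l) = (if i = l then 1 else 0)" if "l \<in> I n" for l
    unfolding B_def
    by (rule matrix_inverse_on[OF I_finite _ i that])
      (rule evolution_matrix_injective[of n "M n", OF M_ode M_init t])
  have "(\<Sum>j\<in>I n. \<Sum>m. S j m) = (\<Sum>j\<in>I n. - (B i j * (\<Sum>l\<in>I n. M n t j l * C' n l)))"
    using sums by (intro sum.cong refl) (auto simp: sums_iff)
  also have "\<dots> = - (\<Sum>l\<in>I n. (\<Sum>j\<in>I n. B i j * M n t j l) * C' n l)"
    unfolding sum_negf sum_distrib_left sum_distrib_right mult.assoc by (subst sum.swap) simp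
  also have "\<dots> = - C' n i"
    using i I_finite[of n] by (simp add: inv if_distrib[of "\<lambda>x. x * _"] cong: if_cong)
  finally show eq: "C' n i + (\<Sum>j\<in>I n. \<Sum>m. S j m) = 0" by simp
  show "C' n i = 0" if "lam n t = 0"
  proof -
    \<comment> \<open>With a zero eigenvalue every \<open>Ldot\<close> from this block vanishes, so
      each term of the series does.\<close>
    have "S j m = 0" if "j \<in> I n" for j m
      unfolding S using Ldot_ground_state[OF \<open>j \<in> I n\<close> _ t \<open>lam n t = 0\<close>] by simp
    then show ?thesis using eq by simp
  qed
qed

end

theorem mainTheorem1:
  fixes \<nu> \<beta> ti :: real
    and V :: "'x::euclidean_space \<Rightarrow> 'p::euclidean_space \<Rightarrow> real"
    and P :: "'p set"
    and a :: "real \<Rightarrow> 'p"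
    and lam :: "nat \<Rightarrow> real \<Rightarrow> real"
    and I :: "nat \<Rightarrow> 'i::zero set"
    and u foot head :: "nat \<Rightarrow> 'i \<Rightarrow> 'x \<Rightarrow> 'p \<Rightarrow> real"
    and N :: "nat \<Rightarrow> 'i \<Rightarrow> 'p \<Rightarrow> real"
    and M :: "nat \<Rightarrow> real \<Rightarrow> 'i \<Rightarrow> 'i \<Rightarrow> real"
    and Ldot :: "nat \<Rightarrow> nat \<Rightarrow> real \<Rightarrow> 'i \<Rightarrow> 'i \<Rightarrow> real"
    and \<rho> :: "'x \<Rightarrow> real \<Rightarrow> real"
    and A C :: "nat \<Rightarrow> 'i \<Rightarrow> real \<Rightarrow> real"
    and R :: "nat \<Rightarrow> 'x \<Rightarrow> real \<Rightarrow> real"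
  assumes "\<nu> > 0" and "\<beta> > 0"
    \<comment> \<open>the potential and the protocol\<close>
    and "open P"
    and V_smooth: "smooth_on (UNIV \<times> P) (\<lambda>(x, p). V x p)"
    and V_confining: "\<And>p. p \<in> P \<Longrightarrow> confining (\<lambda>x. V x p)"
    and a_range: "\<And>t. t \<ge> ti \<Longrightarrow> a t \<in> P"
    and a_smooth: "smooth_on {ti..} a"
    \<comment> \<open>spectral data\<close>
    and I_finite: "\<And>n. finite (I n) \<and> I n \<noteq> {}"
    and I_0: "I 0 = {0}"
    and lam_0: "\<And>t. t \<ge> ti \<Longrightarrow> lam 0 t = 0"
    and lam_mono: "\<And>n t. t \<ge> ti \<Longrightarrow> lam n t < lam (Suc n) t"
    and eigen: "\<And>n i t x. i \<in> I n \<Longrightarrow> t \<ge> ti \<Longrightarrow>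
      hamiltonian \<nu> \<beta> (\<lambda>y. V y (a t)) (\<lambda>y. u n i y (a t)) x = lam n t * u n i x (a t)"
    and complete: "\<And>t. t \<ge> ti \<Longrightarrow> complete_orthonormal I (\<lambda>n i x. u n i x (a t))"
    and lam_smooth: "\<And>n. smooth_on {ti..} (lam n)"
    and u_smooth: "\<And>n i. i \<in> I n \<Longrightarrow> smooth_on (UNIV \<times> {ti..}) (\<lambda>(x, t). u n i x (a t))"
    and u_decay: "\<And>n i. i \<in> I n \<Longrightarrow>
      rapidly_decaying ti (\<lambda>x t. V x (a t)) (\<lambda>x t. u n i x (a t))"
    and N_pos: "\<And>n i t. i \<in> I n \<Longrightarrow> t \<ge> ti \<Longrightarrow> N n i (a t) > 0"
    and N_smooth: "\<And>n i. i \<in> I n \<Longrightarrow> smooth_on {ti..} (\<lambda>t. N n i (a t))"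
    \<comment> \<open>foot states, head states and the matrices built from them\<close>
    and foot: "\<And>n i x p. foot n i x p = sqrt (N n i p) * exp (- \<beta> * V x p / 2) * u n i x p"
    and head: "\<And>n i x p. head n i x p = 1 / sqrt (N n i p) * exp (\<beta> * V x p / 2) * u n i x p"
    and M_ode: "\<And>n i j t. i \<in> I n \<Longrightarrow> j \<in> I n \<Longrightarrow> t \<ge> ti \<Longrightarrow>
      ((\<lambda>s. M n s i j) has_real_derivative
        - (\<Sum>k\<in>I n. (\<integral>x. head n i x (a t) * dt ti (\<lambda>s. foot n k x (a s)) t \<partial>lborel) * M n t k j))
        (at t within {ti..})"
    and M_init: "\<And>n i j. i \<in> I n \<Longrightarrow> j \<in> I n \<Longrightarrow> M n ti i j = (if i = j then 1 else 0)"
    and Ldot: "\<And>n m t i j. Ldot n m t i j =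
      (\<integral>x. head n i x (a t) *
         fokker_planck_dt \<nu> (\<lambda>y. dt ti (\<lambda>s. V y (a s)) t) (\<lambda>y. foot m j y (a t)) x \<partial>lborel)"
    \<comment> \<open>the solution and its expansion, with \<open>R n\<close> the contribution of the \<open>n\<close>-th eigenvalue\<close>
    and solution: "solves_fokker_planck ti \<nu> \<beta> (\<lambda>x t. V x (a t)) \<rho>"
    and \<rho>_decay: "\<And>t k. t \<ge> ti \<Longrightarrow> ((\<lambda>x. norm x ^ k * \<rho> x t) \<longlongrightarrow> 0) at_infinity"
    and C_differentiable: "\<And>n i t. i \<in> I n \<Longrightarrow> t \<ge> ti \<Longrightarrow> C n i differentiable (at t within {ti..})"
    and A: "\<And>n i t. A n i t = (\<Sum>j\<in>I n. M n t i j * C n j t)"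
    and R: "\<And>n x t. R n x t =
      (\<Sum>i\<in>I n. A n i t * exp (- integral {ti..t} (lam n)) * foot n i x (a t))"
    and expansion: "\<And>x t. t \<ge> ti \<Longrightarrow> (\<lambda>n. R n x t) sums \<rho> x t"
    \<comment> \<open>the expansion may be differentiated and integrated term by term\<close>
    and series_dt: "\<And>x t. t \<ge> ti \<Longrightarrow> (\<lambda>n. dt ti (R n x) t) sums dt ti (\<rho> x) t"
    and series_pd: "\<And>b x t. b \<in> Basis \<Longrightarrow> t \<ge> ti \<Longrightarrow>
      (\<lambda>n. pd b (\<lambda>y. R n y t) x) sums pd b (\<lambda>y. \<rho> y t) x"
    and series_pd2: "\<And>b c x t. b \<in> Basis \<Longrightarrow> c \<in> Basis \<Longrightarrow> t \<ge> ti \<Longrightarrow>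
      (\<lambda>n. pd b (pd c (\<lambda>y. R n y t)) x) sums pd b (pd c (\<lambda>y. \<rho> y t)) x"
    and series_int: "\<And>n i t. i \<in> I n \<Longrightarrow> t \<ge> ti \<Longrightarrow>
      integrates_termwise (\<lambda>x. head n i x (a t)) (\<lambda>m x. R m x t) (\<lambda>x. \<rho> x t)"
    and series_int_dt: "\<And>n i t. i \<in> I n \<Longrightarrow> t \<ge> ti \<Longrightarrow>
      integrates_termwise (\<lambda>x. head n i x (a t)) (\<lambda>m x. dt ti (R m x) t) (\<lambda>x. dt ti (\<rho> x) t)"
    and series_int_fp: "\<And>n i t. i \<in> I n \<Longrightarrow> t \<ge> ti \<Longrightarrow>
      integrates_termwise (\<lambda>x. head n i x (a t))
        (\<lambda>m. fokker_planck \<nu> \<beta> (\<lambda>y. V y (a t)) (\<lambda>y. R m y t))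
        (fokker_planck \<nu> \<beta> (\<lambda>y. V y (a t)) (\<lambda>y. \<rho> y t))"
  shows "(\<forall>n. \<forall>i\<in>I n. \<forall>t\<ge>ti.
      let S = (\<lambda>j m. if m = n then 0 else
            (\<Sum>k\<in>I m. \<Sum>l\<in>I m.
               exp (integral {ti..t} (\<lambda>s. lam n s - lam m s)) *
               (matrix_inverse_on (I n) (M n t) i j * Ldot n m t j k * M m t k l
                 / (lam n t - lam m t)) * C m l t))
      in (\<forall>j\<in>I n. summable (S j)) \<and> dt ti (C n i) t + (\<Sum>j\<in>I n. \<Sum>m. S j m) = 0)
    \<and> (\<forall>t\<ge>ti. C 0 0 t = C 0 0 ti)"
proof -
  interpret sys: foot_head_system \<nu> \<beta> ti "\<lambda>x t. V x (a t)" lam I "\<lambda>n i x t. u n i x (a t)" "\<lambda>n i t. N n i (a t)"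
  proof
    have "smooth_on (UNIV \<times> {ti..}) (\<lambda>z. (fst z :: 'x, a (snd z)))"
      by (intro smooth_on_Pair smooth_on_bounded_linear bounded_linear_fst
          smooth_on_compose[OF smooth_on_bounded_linear[OF bounded_linear_snd] _ a_smooth]) auto
    from smooth_on_compose[OF this _ V_smooth] a_range
    show "smooth_on (UNIV \<times> {ti..}) (\<lambda>(x, t). V x (a t))"
      by (auto simp: case_prod_unfold image_subset_iff)
    show "finite (I n)" for n using I_finite by blast
    show "(\<integral>x. u n i x (a t) * u m j x (a t) \<partial>lborel) = (if n = m \<and> i = j then 1 else 0)"
      if "i \<in> I n" "j \<in> I m" "t \<ge> ti" for n m i j t
      using complete[OF that(3)] that(1,2) unfolding complete_orthonormal_def by blast
  qed (fact assms)+
  have foot_eq: "foot n i x (a t) = sys.foot n i x t" for n i x t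
    by (simp add: foot sys.foot_def)
  have head_eq: "head n i x (a t) = sys.head n i x t" for n i x t
    by (simp add: head sys.head_def)
  have Ldot_eq: "Ldot = sys.Ldot"
    by (simp add: fun_eq_iff Ldot sys.Ldot_def foot_eq head_eq)
  have M_ode': "((\<lambda>s. M n s i j) has_real_derivative - (\<Sum>k\<in>I n. sys.coupling n n t i k * M n t k j))
      (at t within {ti..})" if "i \<in> I n" "j \<in> I n" "t \<ge> ti" for n i j t
    using M_ode[OF that] by (simp add: sys.coupling_def foot_eq head_eq)
  have C_dt: "(C n i has_real_derivative dt ti (C n i) t) (at t within {ti..})" if "i \<in> I n" "t \<ge> ti" for n i t
    using C_differentiable[OF that] dt_eqI[OF _ that(2)] by (auto simp: real_differentiable_def)
  have R': "R n x t = (\<Sum>i\<in>I n. A n i t * exp (- integral {ti..t} (lam n)) * sys.foot n i x t)" for n x t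
    by (simp add: R foot_eq)
  have equation: "dt ti (\<rho> x) t = fokker_planck \<nu> \<beta> (\<lambda>y. V y (a t)) (\<lambda>y. \<rho> y t) x" if "t \<ge> ti" for x t
    using solution dt_eqI[OF _ that] that by (auto simp: solves_fokker_planck_def)
  have lam_distinct: "lam n t \<noteq> lam m t" if "t \<ge> ti" "n \<noteq> m" for n m t
    using strict_mono_eq[of "\<lambda>n. lam n t" n m] lam_mono[OF that(1)] that(2)
    by (auto simp: strict_mono_Suc_iff)
  \<comment> \<open>\<open>S\<close> is kept as a variable constrained by an equation, so that the
    body of the \<open>let\<close> can later be supplied by reflexivity.\<close>
  have result: "\<forall>j\<in>I n. summable (S j)" "dt ti (C n i) t + (\<Sum>j\<in>I n. \<Sum>m. S j m) = 0"
    "lam n t = 0 \<Longrightarrow> dt ti (C n i) t = 0"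
    if i: "i \<in> I n" and t: "t \<ge> ti" and S: "\<And>j m. S j m = (if m = n then 0 else
      (\<Sum>k\<in>I m. \<Sum>l\<in>I m. exp (integral {ti..t} (\<lambda>s. lam n s - lam m s)) *
        (matrix_inverse_on (I n) (M n t) i j * Ldot n m t j k * M m t k l
           / (lam n t - lam m t)) * C m l t))" for n i t S
    by (rule sys.coefficient_equation[where S = S and M = M and C = C and A = A and R = R and \<rho> = \<rho>
          and t = t and i = i and n = n and C' = "\<lambda>n i. dt ti (C n i) t"],
        (rule M_ode' M_init lam_distinct[OF t] C_dt[OF _ t] A R' equation[OF t] i t S[unfolded Ldot_eq]
          series_int_dt[unfolded head_eq, OF _ t] series_int_fp[unfolded head_eq, OF _ t] | assumption)+)+
  \<comment> \<open>The derivative within the convex set \<open>{ti..}\<close> is zero because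
    \<open>lam 0\<close> vanishes at every time; this covers the endpoint as well.\<close>
  have "C 0 0 t = C 0 0 ti" if t: "t \<ge> ti" for t
  proof (rule has_field_derivative_zero_constant[of "{ti..}" "C 0 0", THEN exE])
    show "(C 0 0 has_real_derivative 0) (at s within {ti..})" if "s \<in> {ti..}" for s
      using result(3)[OF _ _ refl, of 0 0 s] C_dt[of 0 0 s] that I_0 lam_0 by simp
  qed (use t in auto)
  moreover have "let S = (\<lambda>j m. if m = n then 0 else
            (\<Sum>k\<in>I m. \<Sum>l\<in>I m.
               exp (integral {ti..t} (\<lambda>s. lam n s - lam m s)) *
               (matrix_inverse_on (I n) (M n t) i j * Ldot n m t j k * M m t k l
                 / (lam n t - lam m t)) * C m l t))
      in (\<forall>j\<in>I n. summable (S j)) \<and> dt ti (C n i) t + (\<Sum>j\<in>I n. \<Sum>m. S j m) = 0"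
    if "i \<in> I n" "t \<ge> ti" for n i t
    unfolding Let_def using result(1,2)[OF that refl] by blast
  ultimately show ?thesis by blast
qed

end
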